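(* Let $M$ be a $\Theta$-CR submanifold of a $\Theta$-statistical manifold $(\widetilde M,\widetilde g,\widetilde\nabla,\widetilde\nabla^{*},\Theta)$, with orthogonal decomposition $TM=D_{\Theta}\oplus D_{\Theta}^{\perp}$ into its invariant and anti-invariant distributions. (1) Assume $\ker(F_{\Theta}|_{TM})=D_{\Theta}$. Then $D_{\Theta}$ is $\nabla^{*}$-autoparallel if and only if \[ h(X,\Theta Y)=f_{\Theta}(h^{*}(X,Y)) \] for all $X,Y\in\Gamma(D_{\Theta})$. (2) Assume $\ker(P_{\Theta}|_{TM})=D_{\Theta}^{\perp}$. Then $D_{\Theta}^{\perp}$ is $\nabla^{*}$-autoparallel if and only if \[ A_{\Theta V}U+t_{\Theta}(h^{*}(U,V))=0 \] for all $U,V\in\Gamma(D_{\Theta}^{\perp})$.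
   Context: A statistical manifold $(\widetilde M,\widetilde g,\widetilde\nabla,\widetilde\nabla^{*})$ is a Riemannian manifold $(\widetilde M,\widetilde g)$ with two torsion-free affine connections dual with respect to $\widetilde g$: $X\widetilde g(Y,Z)=\widetilde g(\widetilde\nabla_XY,Z)+\widetilde g(Y,\widetilde\nabla_X^{*}Z)$. It is a $\Theta$-statistical manifold if it is endowed with a nonzero $(1,1)$-tensor field $\Theta$ satisfying the gauge equation $\widetilde\nabla_X(\Theta Y)=\Theta(\widetilde\nabla_X^{*}Y)$ for all vector fields $X,Y$. Let $M\hookrightarrow\widetilde M$ be an isometrically immersed submanifold with induced metric $g$. For $X,Y\in\Gamma(TM)$ and $\nu\in\Gamma(T^{\perp}M)$, the statistical Gauss--Weingarten formulas (splitting into tangential and normal parts) are \[ \widetilde\nabla_XY=\nabla_XY+h(X,Y),\quad \widetilde\nabla^{*}_XY=\nabla^{*}_XY+h^{*}(X,Y),\quad \widetilde\nabla_X\nu=-A_{\nu}X+\nabla^{\perp}_X\nu, \] which define the induced connections $\nabla,\nabla^{*}$ on $M$, the second fundamental forms $h,h^{*}$, the shape operator $A_\nu$ and the normal connection $\nabla^{\perp}$. Along $M$, write $\Theta Y=P_{\Theta}Y+F_{\Theta}Y$ for $Y\in\Gamma(TM)$, with $P_{\Theta}Y\in\Gamma(TM)$, $F_{\Theta}Y\in\Gamma(T^{\perp}M)$, and $\Theta\nu=t_{\Theta}\nu+f_{\Theta}\nu$ for $\nu\in\Gamma(T^{\perp}M)$, with $t_{\Theta}\nu\in\Gamma(TM)$,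 $f_{\Theta}\nu\in\Gamma(T^{\perp}M)$. $M$ is a $\Theta$-CR submanifold if $TM$ admits an orthogonal decomposition $TM=D_{\Theta}\oplus D_{\Theta}^{\perp}$ into distributions such that $\Theta(D_{\Theta})\subset D_{\Theta}$ and $\Theta(D_{\Theta}^{\perp})\subset T^{\perp}M$; $D_\Theta$ and $D_\Theta^\perp$ are called the invariant and anti-invariant distributions. A distribution $D\subset TM$ is $\nabla^{*}$-autoparallel if $\nabla^{*}_XY\in\Gamma(D)$ for all $X,Y\in\Gamma(D)$. *)

theory Defs
  imports "HOL-Analysis.Analysis"
begin

section \<open>Smooth functions on open subsets of Euclidean space\<close>

primrec Ck_on :: "nat \<Rightarrow> ('e::euclidean_space \<Rightarrow> 'v::real_normed_vector) \<Rightarrow> 'e set \<Rightarrow> bool" where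
  "Ck_on 0 f S \<longleftrightarrow> continuous_on S f"
| "Ck_on (Suc k) f S \<longleftrightarrow> (\<forall>x\<in>S. f differentiable (at x)) \<and>
     (\<forall>u. Ck_on k (\<lambda>x. frechet_derivative f (at x) u) S)"

definition smooth_on :: "'e::euclidean_space set \<Rightarrow> ('e \<Rightarrow> 'v::real_normed_vector) \<Rightarrow> bool" where
  "smooth_on S f \<longleftrightarrow> (\<forall>k. Ck_on k f S)"


section \<open>Smooth manifolds, tangent vectors, vector fields\<close>

text \<open>A manifold is a whole type, Hausdorff and second countable, together with a smooth atlas
  modelled on a Euclidean space. A chart is a pair of its domain and its coordinate map; the values
  of the coordinate map outside the domain are irrelevant.\<close>

type_synonym ('a, 'e) chart = "'a set \<times> ('a \<Rightarrow> 'e)"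
type_synonym ('a, 'e) atlas = "('a, 'e) chart set"

definition chart_inv :: "('a, 'e) chart \<Rightarrow> 'e \<Rightarrow> 'a" where
  "chart_inv c = inv_into (fst c) (snd c)"

definition smooth_atlas ::
  "('a::{t2_space, second_countable_topology}, 'e::euclidean_space) atlas \<Rightarrow> bool" where
  "smooth_atlas A \<longleftrightarrow>
     (\<forall>c\<in>A. open (fst c) \<and> open (snd c ` fst c) \<and>
            (\<exists>\<psi>. homeomorphism (fst c) (snd c ` fst c) (snd c) \<psi>)) \<and>
     (\<Union>c\<in>A. fst c) = UNIV \<and>
     (\<forall>c\<in>A. \<forall>d\<in>A. smooth_on (snd c ` (fst c \<inter> fst d)) (snd d \<circ> chart_inv c))"

definition smooth_function :: "('a, 'e::euclidean_space) atlas \<Rightarrow> ('a \<Rightarrow> real) \<Rightarrow> bool" where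
  "smooth_function A f \<longleftrightarrow> (\<forall>c\<in>A. smooth_on (snd c ` fst c) (f \<circ> chart_inv c))"

text \<open>A tangent vector at \<open>p\<close> is the family of its coordinate vectors in all charts around \<open>p\<close>,
  related by the derivatives of the transition maps. The entries at all other pairs \<open>c\<close> are set to 0,
  so that equality of tangent vectors is equality of functions and the vector space operations
  are pointwise.\<close>

type_synonym ('a, 'e) tvec = "('a, 'e) chart \<Rightarrow> 'e"
type_synonym ('a, 'e) vfield = "'a \<Rightarrow> ('a, 'e) tvec"

definition tangent_space ::
  "('a, 'e::euclidean_space) atlas \<Rightarrow> 'a \<Rightarrow> ('a, 'e) tvec set" where
  "tangent_space A p = {v.
     (\<forall>c\<in>A. \<forall>d\<in>A. p \<in> fst c \<and> p \<in> fst d \<longrightarrow>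
        v d = frechet_derivative (snd d \<circ> chart_inv c) (at (snd c p)) (v c)) \<and>
     (\<forall>c. \<not> (c \<in> A \<and> p \<in> fst c) \<longrightarrow> v c = 0)}"

definition tzero :: "('a, 'e::real_vector) tvec" where
  "tzero = (\<lambda>c. 0)"

definition tadd :: "('a, 'e::real_vector) tvec \<Rightarrow> ('a, 'e) tvec \<Rightarrow> ('a, 'e) tvec" where
  "tadd v w = (\<lambda>c. v c + w c)"

definition tsub :: "('a, 'e::real_vector) tvec \<Rightarrow> ('a, 'e) tvec \<Rightarrow> ('a, 'e) tvec" where
  "tsub v w = (\<lambda>c. v c - w c)"

definition tscale :: "real \<Rightarrow> ('a, 'e::real_vector) tvec \<Rightarrow> ('a, 'e) tvec" where
  "tscale a v = (\<lambda>c. a *\<^sub>R v c)"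

text \<open>The coordinate vector with coordinates \<open>u\<close> at \<open>p\<close> in the chart \<open>c\<close>.\<close>

definition coord_vec ::
  "('a, 'e::euclidean_space) atlas \<Rightarrow> ('a, 'e) chart \<Rightarrow> 'a \<Rightarrow> 'e \<Rightarrow> ('a, 'e) tvec" where
  "coord_vec A c p u = (\<lambda>d. if d \<in> A \<and> p \<in> fst d
     then frechet_derivative (snd d \<circ> chart_inv c) (at (snd c p)) u else 0)"

definition chart_at :: "('a, 'e) atlas \<Rightarrow> 'a \<Rightarrow> ('a, 'e) chart" where
  "chart_at A p = (SOME c. c \<in> A \<and> p \<in> fst c)"

text \<open>The derivative \<open>v(f)\<close> of a function \<open>f\<close> along a tangent vector \<open>v\<close> at \<open>p\<close>. It does
  not depend on the chart, and only the values of \<open>f\<close> near \<open>p\<close> matter.\<close>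

definition tderiv ::
  "('a, 'e::euclidean_space) atlas \<Rightarrow> 'a \<Rightarrow> ('a, 'e) tvec \<Rightarrow> ('a \<Rightarrow> 'v::real_normed_vector) \<Rightarrow> 'v" where
  "tderiv A p v f = (let c = chart_at A p in
     frechet_derivative (f \<circ> chart_inv c) (at (snd c p)) (v c))"

definition vector_field_on ::
  "('a, 'e::euclidean_space) atlas \<Rightarrow> 'a set \<Rightarrow> ('a, 'e) vfield \<Rightarrow> bool" where
  "vector_field_on A U X \<longleftrightarrow> (\<forall>p\<in>U. X p \<in> tangent_space A p) \<and>
     (\<forall>c\<in>A. smooth_on (snd c ` (fst c \<inter> U)) (\<lambda>x. X (chart_inv c x) c))"

definition vector_fields :: "('a, 'e::euclidean_space) atlas \<Rightarrow> ('a, 'e) vfield set" where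
  "vector_fields A = {X. vector_field_on A UNIV X}"

definition lie_bracket ::
  "('a, 'e::euclidean_space) atlas \<Rightarrow> ('a, 'e) vfield \<Rightarrow> ('a, 'e) vfield \<Rightarrow> ('a, 'e) vfield" where
  "lie_bracket A X Y = (\<lambda>p c. if c \<in> A \<and> p \<in> fst c
     then tderiv A p (X p) (\<lambda>q. Y q c) - tderiv A p (Y p) (\<lambda>q. X q c) else 0)"


section \<open>Statistical manifolds\<close>

type_synonym ('a, 'e) metric = "'a \<Rightarrow> ('a, 'e) tvec \<Rightarrow> ('a, 'e) tvec \<Rightarrow> real"
type_synonym ('a, 'e) connection = "('a, 'e) vfield \<Rightarrow> ('a, 'e) vfield \<Rightarrow> ('a, 'e) vfield"
type_synonym ('a, 'e) tensor11 = "'a \<Rightarrow> ('a, 'e) tvec \<Rightarrow> ('a, 'e) tvec"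

definition riemannian_metric ::
  "('a, 'e::euclidean_space) atlas \<Rightarrow> ('a, 'e) metric \<Rightarrow> bool" where
  "riemannian_metric A g \<longleftrightarrow>
     (\<forall>p. \<forall>u\<in>tangent_space A p. \<forall>v\<in>tangent_space A p. g p u v = g p v u) \<and>
     (\<forall>p. \<forall>u\<in>tangent_space A p. \<forall>v\<in>tangent_space A p. \<forall>w\<in>tangent_space A p.
        g p (tadd u v) w = g p u w + g p v w) \<and>
     (\<forall>p a. \<forall>u\<in>tangent_space A p. \<forall>v\<in>tangent_space A p. g p (tscale a u) v = a * g p u v) \<and>
     (\<forall>p. \<forall>u\<in>tangent_space A p. u \<noteq> tzero \<longrightarrow> g p u u > 0) \<and>
     (\<forall>c\<in>A. \<forall>u v. smooth_on (snd c ` fst c)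
        (\<lambda>x. g (chart_inv c x) (coord_vec A c (chart_inv c x) u) (coord_vec A c (chart_inv c x) v)))"

definition tensor_field11 ::
  "('a, 'e::euclidean_space) atlas \<Rightarrow> ('a, 'e) tensor11 \<Rightarrow> bool" where
  "tensor_field11 A \<Theta> \<longleftrightarrow>
     (\<forall>p. \<forall>v\<in>tangent_space A p. \<Theta> p v \<in> tangent_space A p) \<and>
     (\<forall>p. \<forall>v\<in>tangent_space A p. \<forall>w\<in>tangent_space A p.
        \<Theta> p (tadd v w) = tadd (\<Theta> p v) (\<Theta> p w)) \<and>
     (\<forall>p a. \<forall>v\<in>tangent_space A p. \<Theta> p (tscale a v) = tscale a (\<Theta> p v)) \<and>
     (\<forall>c\<in>A. \<forall>u. smooth_on (snd c ` fst c)
        (\<lambda>x. \<Theta> (chart_inv c x) (coord_vec A c (chart_inv c x) u) c))"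

definition affine_connection ::
  "('a, 'e::euclidean_space) atlas \<Rightarrow> ('a, 'e) connection \<Rightarrow> bool" where
  "affine_connection A nab \<longleftrightarrow>
     (\<forall>X\<in>vector_fields A. \<forall>Y\<in>vector_fields A. nab X Y \<in> vector_fields A) \<and>
     (\<forall>X\<in>vector_fields A. \<forall>Y\<in>vector_fields A. \<forall>Z\<in>vector_fields A.
        nab (\<lambda>p. tadd (X p) (Y p)) Z = (\<lambda>p. tadd (nab X Z p) (nab Y Z p))) \<and>
     (\<forall>X\<in>vector_fields A. \<forall>Y\<in>vector_fields A. \<forall>Z\<in>vector_fields A.
        nab X (\<lambda>p. tadd (Y p) (Z p)) = (\<lambda>p. tadd (nab X Y p) (nab X Z p))) \<and>
     (\<forall>f. \<forall>X\<in>vector_fields A. \<forall>Y\<in>vector_fields A. smooth_function A f \<longrightarrow>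
        nab (\<lambda>p. tscale (f p) (X p)) Y = (\<lambda>p. tscale (f p) (nab X Y p))) \<and>
     (\<forall>f. \<forall>X\<in>vector_fields A. \<forall>Y\<in>vector_fields A. smooth_function A f \<longrightarrow>
        nab X (\<lambda>p. tscale (f p) (Y p)) =
        (\<lambda>p. tadd (tscale (tderiv A p (X p) f) (Y p)) (tscale (f p) (nab X Y p))))"

definition torsion_free ::
  "('a, 'e::euclidean_space) atlas \<Rightarrow> ('a, 'e) connection \<Rightarrow> bool" where
  "torsion_free A nab \<longleftrightarrow> (\<forall>X\<in>vector_fields A. \<forall>Y\<in>vector_fields A. \<forall>p.
     tsub (nab X Y p) (nab Y X p) = lie_bracket A X Y p)"

definition dual_connections ::
  "('a, 'e::euclidean_space) atlas \<Rightarrow> ('a, 'e) metric \<Rightarrow> ('a, 'e) connection \<Rightarrow>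
   ('a, 'e) connection \<Rightarrow> bool" where
  "dual_connections A g nab nabs \<longleftrightarrow>
     (\<forall>X\<in>vector_fields A. \<forall>Y\<in>vector_fields A. \<forall>Z\<in>vector_fields A. \<forall>p.
        tderiv A p (X p) (\<lambda>q. g q (Y q) (Z q)) =
        g p (nab X Y p) (Z p) + g p (Y p) (nabs X Z p))"

definition statistical_manifold ::
  "('a::{t2_space, second_countable_topology}, 'e::euclidean_space) atlas \<Rightarrow> ('a, 'e) metric \<Rightarrow>
   ('a, 'e) connection \<Rightarrow> ('a, 'e) connection \<Rightarrow> bool" where
  "statistical_manifold A g nab nabs \<longleftrightarrow>
     smooth_atlas A \<and> riemannian_metric A g \<and>
     affine_connection A nab \<and> affine_connection A nabs \<and>
     torsion_free A nab \<and> torsion_free A nabs \<and> dual_connections A g nab nabs"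

definition theta_statistical_manifold ::
  "('a::{t2_space, second_countable_topology}, 'e::euclidean_space) atlas \<Rightarrow> ('a, 'e) metric \<Rightarrow>
   ('a, 'e) connection \<Rightarrow> ('a, 'e) connection \<Rightarrow> ('a, 'e) tensor11 \<Rightarrow> bool" where
  "theta_statistical_manifold A g nab nabs \<Theta> \<longleftrightarrow>
     statistical_manifold A g nab nabs \<and> tensor_field11 A \<Theta> \<and>
     (\<exists>p. \<exists>v\<in>tangent_space A p. \<Theta> p v \<noteq> tzero) \<and>
     (\<forall>X\<in>vector_fields A. \<forall>Y\<in>vector_fields A. \<forall>p.
        nab X (\<lambda>q. \<Theta> q (Y q)) p = \<Theta> p (nabs X Y p))"


section \<open>Immersed submanifolds\<close>

definition smooth_map ::
  "('b::topological_space, 'f::euclidean_space) atlas \<Rightarrow>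
   ('a::topological_space, 'e::euclidean_space) atlas \<Rightarrow> ('b \<Rightarrow> 'a) \<Rightarrow> bool" where
  "smooth_map B A \<iota> \<longleftrightarrow> continuous_on UNIV \<iota> \<and>
     (\<forall>c\<in>B. \<forall>d\<in>A. smooth_on (snd c ` (fst c \<inter> \<iota> -` fst d)) (snd d \<circ> \<iota> \<circ> chart_inv c))"

definition push ::
  "('b, 'f::euclidean_space) atlas \<Rightarrow> ('a, 'e::euclidean_space) atlas \<Rightarrow> ('b \<Rightarrow> 'a) \<Rightarrow> 'b \<Rightarrow>
   ('b, 'f) tvec \<Rightarrow> ('a, 'e) tvec" where
  "push B A \<iota> p v = (\<lambda>d. if d \<in> A \<and> \<iota> p \<in> fst d then tderiv B p v (snd d \<circ> \<iota>) else 0)"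

definition immersion ::
  "('b::topological_space, 'f::euclidean_space) atlas \<Rightarrow>
   ('a::topological_space, 'e::euclidean_space) atlas \<Rightarrow> ('b \<Rightarrow> 'a) \<Rightarrow> bool" where
  "immersion B A \<iota> \<longleftrightarrow> smooth_map B A \<iota> \<and> (\<forall>p. inj_on (push B A \<iota> p) (tangent_space B p))"

definition induced_metric ::
  "('b, 'f::euclidean_space) atlas \<Rightarrow> ('a, 'e::euclidean_space) atlas \<Rightarrow> ('a, 'e) metric \<Rightarrow>
   ('b \<Rightarrow> 'a) \<Rightarrow> ('b, 'f) metric" where
  "induced_metric B A g \<iota> = (\<lambda>p u v. g (\<iota> p) (push B A \<iota> p u) (push B A \<iota> p v))"

definition normal_space ::
  "('b, 'f::euclidean_space) atlas \<Rightarrow> ('a, 'e::euclidean_space) atlas \<Rightarrow> ('a, 'e) metric \<Rightarrow>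
   ('b \<Rightarrow> 'a) \<Rightarrow> 'b \<Rightarrow> ('a, 'e) tvec set" where
  "normal_space B A g \<iota> p = {w \<in> tangent_space A (\<iota> p).
     \<forall>v\<in>tangent_space B p. g (\<iota> p) w (push B A \<iota> p v) = 0}"

text \<open>The splitting of a tangent vector of the ambient manifold at \<open>\<iota> p\<close>. The tangential part is
  given as a tangent vector of the submanifold, the normal part as an ambient one.\<close>

definition tan_part ::
  "('b, 'f::euclidean_space) atlas \<Rightarrow> ('a, 'e::euclidean_space) atlas \<Rightarrow> ('a, 'e) metric \<Rightarrow>
   ('b \<Rightarrow> 'a) \<Rightarrow> 'b \<Rightarrow> ('a, 'e) tvec \<Rightarrow> ('b, 'f) tvec" where
  "tan_part B A g \<iota> p w = (THE v. v \<in> tangent_space B p \<and>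
     tsub w (push B A \<iota> p v) \<in> normal_space B A g \<iota> p)"

definition nor_part ::
  "('b, 'f::euclidean_space) atlas \<Rightarrow> ('a, 'e::euclidean_space) atlas \<Rightarrow> ('a, 'e) metric \<Rightarrow>
   ('b \<Rightarrow> 'a) \<Rightarrow> 'b \<Rightarrow> ('a, 'e) tvec \<Rightarrow> ('a, 'e) tvec" where
  "nor_part B A g \<iota> p w = tsub w (push B A \<iota> p (tan_part B A g \<iota> p w))"

text \<open>The Christoffel symbols of a connection in the chart \<open>c\<close> at \<open>q\<close>, as a bilinear map: the
  coordinate vector at \<open>q\<close> of \<open>\<nabla>\<^sub>X Y\<close>, where near \<open>q\<close> the vector fields
  \<open>X\<close> and \<open>Y\<close> have the constant coordinates \<open>u\<close> and \<open>w\<close> in the chart \<open>c\<close>. Since connections act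
  on globally defined fields, \<open>X\<close> and \<open>Y\<close> are arbitrary global extensions.\<close>

definition christoffel ::
  "('a::topological_space, 'e::euclidean_space) atlas \<Rightarrow> ('a, 'e) connection \<Rightarrow> ('a, 'e) chart \<Rightarrow>
   'a \<Rightarrow> 'e \<Rightarrow> 'e \<Rightarrow> 'e" where
  "christoffel A nab c q u w = (THE z. \<forall>X\<in>vector_fields A. \<forall>Y\<in>vector_fields A.
     (\<exists>U. open U \<and> q \<in> U \<and> (\<forall>r\<in>U \<inter> fst c. X r c = u \<and> Y r c = w)) \<longrightarrow> nab X Y q c = z)"

text \<open>The ambient connection acts on a field \<open>W\<close> along \<open>\<iota>\<close> (so \<open>W p\<close> is tangent to the ambient
  manifold at \<open>\<iota> p\<close>) as the pull-back connection, that is, in ambient coordinates,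
  \<open>(\<nabla>\<^sub>X W)\<^sup>k = X(W\<^sup>k) + \<Gamma>\<^sup>k\<^sub>i\<^sub>j (d\<iota> X)\<^sup>i W\<^sup>j\<close>.
  This is what differentiating arbitrary local extensions of \<open>X\<close> and \<open>W\<close> to the ambient
  manifold amounts to.\<close>

definition along_deriv ::
  "('b, 'f::euclidean_space) atlas \<Rightarrow> ('a::topological_space, 'e::euclidean_space) atlas \<Rightarrow>
   ('b \<Rightarrow> 'a) \<Rightarrow> ('a, 'e) connection \<Rightarrow> ('b, 'f) vfield \<Rightarrow> ('b \<Rightarrow> ('a, 'e) tvec) \<Rightarrow>
   ('b \<Rightarrow> ('a, 'e) tvec)" where
  "along_deriv B A \<iota> nab X W = (\<lambda>p d. if d \<in> A \<and> \<iota> p \<in> fst d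
     then tderiv B p (X p) (\<lambda>q. W q d) +
          christoffel A nab d (\<iota> p) (push B A \<iota> p (X p) d) (W p d)
     else 0)"

text \<open>The Gauss and Weingarten formulas. Applied to the dual ambient connection, the first two
  definitions give the dual induced connection and the dual second fundamental form.\<close>

definition induced_connection ::
  "('b, 'f::euclidean_space) atlas \<Rightarrow> ('a::topological_space, 'e::euclidean_space) atlas \<Rightarrow>
   ('a, 'e) metric \<Rightarrow> ('b \<Rightarrow> 'a) \<Rightarrow> ('a, 'e) connection \<Rightarrow> ('b, 'f) connection" where
  "induced_connection B A g \<iota> nab X Y =
     (\<lambda>p. tan_part B A g \<iota> p (along_deriv B A \<iota> nab X (\<lambda>q. push B A \<iota> q (Y q)) p))"

definition second_form ::
  "('b, 'f::euclidean_space) atlas \<Rightarrow> ('a::topological_space, 'e::euclidean_space) atlas \<Rightarrow>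
   ('a, 'e) metric \<Rightarrow> ('b \<Rightarrow> 'a) \<Rightarrow> ('a, 'e) connection \<Rightarrow>
   ('b, 'f) vfield \<Rightarrow> ('b, 'f) vfield \<Rightarrow> ('b \<Rightarrow> ('a, 'e) tvec)" where
  "second_form B A g \<iota> nab X Y =
     (\<lambda>p. nor_part B A g \<iota> p (along_deriv B A \<iota> nab X (\<lambda>q. push B A \<iota> q (Y q)) p))"

definition shape_operator ::
  "('b, 'f::euclidean_space) atlas \<Rightarrow> ('a::topological_space, 'e::euclidean_space) atlas \<Rightarrow>
   ('a, 'e) metric \<Rightarrow> ('b \<Rightarrow> 'a) \<Rightarrow> ('a, 'e) connection \<Rightarrow>
   ('b \<Rightarrow> ('a, 'e) tvec) \<Rightarrow> ('b, 'f) vfield \<Rightarrow> ('b, 'f) vfield" where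
  "shape_operator B A g \<iota> nab \<nu> X =
     (\<lambda>p. tscale (-1) (tan_part B A g \<iota> p (along_deriv B A \<iota> nab X \<nu> p)))"

definition P_part ::
  "('b, 'f::euclidean_space) atlas \<Rightarrow> ('a, 'e::euclidean_space) atlas \<Rightarrow> ('a, 'e) metric \<Rightarrow>
   ('b \<Rightarrow> 'a) \<Rightarrow> ('a, 'e) tensor11 \<Rightarrow> 'b \<Rightarrow> ('b, 'f) tvec \<Rightarrow> ('b, 'f) tvec" where
  "P_part B A g \<iota> \<Theta> p v = tan_part B A g \<iota> p (\<Theta> (\<iota> p) (push B A \<iota> p v))"

definition F_part ::
  "('b, 'f::euclidean_space) atlas \<Rightarrow> ('a, 'e::euclidean_space) atlas \<Rightarrow> ('a, 'e) metric \<Rightarrow>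
   ('b \<Rightarrow> 'a) \<Rightarrow> ('a, 'e) tensor11 \<Rightarrow> 'b \<Rightarrow> ('b, 'f) tvec \<Rightarrow> ('a, 'e) tvec" where
  "F_part B A g \<iota> \<Theta> p v = nor_part B A g \<iota> p (\<Theta> (\<iota> p) (push B A \<iota> p v))"

definition t_part ::
  "('b, 'f::euclidean_space) atlas \<Rightarrow> ('a, 'e::euclidean_space) atlas \<Rightarrow> ('a, 'e) metric \<Rightarrow>
   ('b \<Rightarrow> 'a) \<Rightarrow> ('a, 'e) tensor11 \<Rightarrow> 'b \<Rightarrow> ('a, 'e) tvec \<Rightarrow> ('b, 'f) tvec" where
  "t_part B A g \<iota> \<Theta> p \<nu> = tan_part B A g \<iota> p (\<Theta> (\<iota> p) \<nu>)"

definition f_part ::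
  "('b, 'f::euclidean_space) atlas \<Rightarrow> ('a, 'e::euclidean_space) atlas \<Rightarrow> ('a, 'e) metric \<Rightarrow>
   ('b \<Rightarrow> 'a) \<Rightarrow> ('a, 'e) tensor11 \<Rightarrow> 'b \<Rightarrow> ('a, 'e) tvec \<Rightarrow> ('a, 'e) tvec" where
  "f_part B A g \<iota> \<Theta> p \<nu> = nor_part B A g \<iota> p (\<Theta> (\<iota> p) \<nu>)"


section \<open>Distributions and CR submanifolds\<close>

text \<open>A distribution is a smooth subbundle of the tangent bundle, given by local frames; rank 0 is
  allowed, and the rank is only required to be locally constant.\<close>

definition distribution ::
  "('b::topological_space, 'f::euclidean_space) atlas \<Rightarrow> ('b \<Rightarrow> ('b, 'f) tvec set) \<Rightarrow> bool" where
  "distribution B D \<longleftrightarrow> (\<forall>p. \<exists>U (k::nat) E. open U \<and> p \<in> U \<and>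
     (\<forall>i<k. vector_field_on B U (E i)) \<and>
     (\<forall>q\<in>U. D q = {v. \<exists>a::nat \<Rightarrow> real. v = (\<lambda>c. \<Sum>i<k. a i *\<^sub>R E i q c)}) \<and>
     (\<forall>q\<in>U. \<forall>a::nat \<Rightarrow> real. (\<lambda>c. \<Sum>i<k. a i *\<^sub>R E i q c) = tzero \<longrightarrow> (\<forall>i<k. a i = 0)))"

definition sections ::
  "('b, 'f::euclidean_space) atlas \<Rightarrow> ('b \<Rightarrow> ('b, 'f) tvec set) \<Rightarrow> ('b, 'f) vfield set" where
  "sections B D = {X \<in> vector_fields B. \<forall>p. X p \<in> D p}"

definition autoparallel ::
  "('b, 'f::euclidean_space) atlas \<Rightarrow> ('b, 'f) connection \<Rightarrow> ('b \<Rightarrow> ('b, 'f) tvec set) \<Rightarrow> bool" where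
  "autoparallel B nab D \<longleftrightarrow> (\<forall>X\<in>sections B D. \<forall>Y\<in>sections B D. nab X Y \<in> sections B D)"

definition theta_CR_submanifold ::
  "('b::{t2_space, second_countable_topology}, 'f::euclidean_space) atlas \<Rightarrow>
   ('a::{t2_space, second_countable_topology}, 'e::euclidean_space) atlas \<Rightarrow>
   ('a, 'e) metric \<Rightarrow> ('a, 'e) tensor11 \<Rightarrow> ('b \<Rightarrow> 'a) \<Rightarrow>
   ('b \<Rightarrow> ('b, 'f) tvec set) \<Rightarrow> ('b \<Rightarrow> ('b, 'f) tvec set) \<Rightarrow> bool" where
  "theta_CR_submanifold B A g \<Theta> \<iota> D Dp \<longleftrightarrow>
     smooth_atlas B \<and> immersion B A \<iota> \<and> distribution B D \<and> distribution B Dp \<and>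
     (\<forall>p. \<forall>u\<in>D p. \<forall>v\<in>Dp p. induced_metric B A g \<iota> p u v = 0) \<and>
     (\<forall>p. tangent_space B p = {tadd u v |u v. u \<in> D p \<and> v \<in> Dp p}) \<and>
     (\<forall>p. \<forall>u\<in>D p. \<Theta> (\<iota> p) (push B A \<iota> p u) \<in> push B A \<iota> p ` D p) \<and>
     (\<forall>p. \<forall>v\<in>Dp p. \<Theta> (\<iota> p) (push B A \<iota> p v) \<in> normal_space B A g \<iota> p)"

text \<open>For a field \<open>Y\<close> in the invariant distribution, \<open>\<Theta>Y\<close> is again tangent to the submanifold; as
  a vector field of the submanifold it is \<open>\<lambda>p. theta_tan B A \<iota> \<Theta> p (Y p)\<close>.\<close>

definition theta_tan ::
  "('b, 'f::euclidean_space) atlas \<Rightarrow> ('a, 'e::euclidean_space) atlas \<Rightarrow>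
   ('b \<Rightarrow> 'a) \<Rightarrow> ('a, 'e) tensor11 \<Rightarrow> 'b \<Rightarrow> ('b, 'f) tvec \<Rightarrow> ('b, 'f) tvec" where
  "theta_tan B A \<iota> \<Theta> p v = (THE w. w \<in> tangent_space B p \<and>
     push B A \<iota> p w = \<Theta> (\<iota> p) (push B A \<iota> p v))"

end

theory Submission
  imports Defs
begin

text \<open>
  The idea is to differentiate \<open>\<Theta> Y\<close> for a field \<open>Y\<close> of the submanifold. The gauge equation turns the
  ambient derivative into \<open>\<nabla>\<^sub>X (\<Theta> Y) = \<Theta> (\<nabla>\<^sup>*\<^sub>X Y + h\<^sup>*(X, Y))\<close>, where now \<open>\<nabla>\<^sup>*\<close> is the induced
  dual connection. Its normal part is \<open>F (\<nabla>\<^sup>*\<^sub>X Y) + f (h\<^sup>*(X, Y))\<close> and its tangential part is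
  \<open>P (\<nabla>\<^sup>*\<^sub>X Y) + t (h\<^sup>*(X, Y))\<close> (lemma \<open>gauss_weingarten_tensor\<close>). On the invariant distribution \<open>\<Theta> Y\<close>
  is tangent and the normal part is also \<open>h(X, \<Theta> Y)\<close>, so the equation in (1) says \<open>F (\<nabla>\<^sup>*\<^sub>X Y) = 0\<close>. On
  the anti-invariant distribution the tangential part is \<open>- A\<^bsub>\<Theta> V\<^esub> U\<close>, so the equation in (2)
  says \<open>P (\<nabla>\<^sup>*\<^sub>U V) = 0\<close>. The two kernel hypotheses translate these into membership of the distribution.

  Two points behind this computation need work. First, the gauge equation is about
  global ambient fields, whereas \<open>Y\<close> and \<open>\<Theta> Y\<close> live on the submanifold only and are differentiated with
  Christoffel symbols. Here local frames of global fields, obtained with bump functions, do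
  everything: connections are local (\<open>conn_vanish\<close>), so the Christoffel symbols are well defined and bilinear
  (\<open>christoffel_frame\<close>), the derivative along \<open>\<iota>\<close> obeys the Leibniz rule for expansions
  \<open>\<Sum> a\<^sub>i (E\<^sub>i \<circ> \<iota>)\<close> in ambient fields (\<open>along_deriv_sum\<close>), and the gauge equation, applied to
  the \<open>E\<^sub>i\<close>, carries over to fields along \<open>\<iota>\<close> (\<open>tensor_along\<close>).

  Second, an autoparallel distribution requires \<open>\<nabla>\<^sup>*\<^sub>X Y\<close> to be a smooth section, so the
  tangential projection has to preserve smoothness. In coordinates it is the solution of a
  linear system with the Gram matrix of the coordinate fields, and this solution is made explicit, hence smooth,
  by Gram--Schmidt orthogonalisation (\<open>smooth_riesz\<close>, \<open>tan_part_field\<close>).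
\<close>

section \<open>Calculus of smooth functions on Euclidean space\<close>

lemma Ck_on_Suc_imp: "Ck_on (Suc k) f S \<Longrightarrow> Ck_on k f S"
proof (induction k arbitrary: f)
  case 0
  then have "\<And>x. x \<in> S \<Longrightarrow> f differentiable (at x)" by simp
  then show ?case
    by (simp add: differentiable_imp_continuous_within continuous_at_imp_continuous_on)
next
  case (Suc k)
  have diff: "\<forall>x\<in>S. f differentiable (at x)"
    and D: "Ck_on (Suc k) (\<lambda>x. frechet_derivative f (at x) u) S" for u
    using Suc.prems unfolding Ck_on.simps(2)[of "Suc k"] by blast+
  have "Ck_on k (\<lambda>x. frechet_derivative f (at x) u) S" for u
    by (rule Suc.IH[OF D])
  with diff show ?case unfolding Ck_on.simps(2) by blast
qed

lemma Ck_on_subset: "Ck_on k f S \<Longrightarrow> T \<subseteq> S \<Longrightarrow> Ck_on k f T"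
  by (induction k arbitrary: f) (auto intro: continuous_on_subset)

lemma Ck_on_cong:
  assumes "open S" "\<And>x. x \<in> S \<Longrightarrow> f x = g x" "Ck_on k f S"
  shows "Ck_on k g S"
  using assms(2,3)
proof (induction k arbitrary: f g)
  case 0
  then show ?case using continuous_on_cong[OF refl, of S f g] by simp
next
  case (Suc k)
  have D: "(g has_derivative frechet_derivative f (at x)) (at x)" if "x \<in> S" for x
  proof -
    have "(f has_derivative frechet_derivative f (at x)) (at x)"
      using Suc.prems(2) that by (simp add: frechet_derivative_works)
    then show ?thesis
      by (rule has_derivative_transform_within_open[OF _ assms(1) that Suc.prems(1)])
  qed
  have eq: "frechet_derivative f (at x) u = frechet_derivative g (at x) u" if "x \<in> S" for x u
    using fun_cong[OF frechet_derivative_at[OF D[OF that]]] by simp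
  have "Ck_on k (\<lambda>x. frechet_derivative f (at x) u) S" for u
    using Suc.prems(2) by simp
  then have "Ck_on k (\<lambda>x. frechet_derivative g (at x) u) S" for u
    by (rule Suc.IH[rotated]) (rule eq)
  moreover have "g differentiable (at x)" if "x \<in> S" for x
    using D[OF that] by (rule differentiableI)
  ultimately show ?case by simp
qed

text \<open>The definition of \<open>Ck_on\<close> speaks of \<open>frechet_derivative\<close>, a choice of
  derivative; this rule accepts whatever formula the differentiation rules produce. With it,
  closure under products, compositions and inverses is an induction on the order of
  differentiability.\<close>

lemma Ck_on_SucI:
  assumes "open S" "\<And>x. x \<in> S \<Longrightarrow> (f has_derivative f' x) (at x)"
    and "\<And>u. Ck_on k (\<lambda>x. f' x u) S"
  shows "Ck_on (Suc k) f S"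
proof -
  have "f' x u = frechet_derivative f (at x) u" if "x \<in> S" for x u
    using fun_cong[OF frechet_derivative_at[OF assms(2)[OF that]]] by simp
  then have "Ck_on k (\<lambda>x. frechet_derivative f (at x) u) S" for u
    by (rule Ck_on_cong[OF assms(1) _ assms(3)])
  moreover have "f differentiable (at x)" if "x \<in> S" for x
    using assms(2)[OF that] by (rule differentiableI)
  ultimately show ?thesis by simp
qed

lemma Ck_on_SucD:
  assumes "Ck_on (Suc k) f S"
  shows "x \<in> S \<Longrightarrow> (f has_derivative frechet_derivative f (at x)) (at x)"
    and "Ck_on k (\<lambda>x. frechet_derivative f (at x) u) S"
  using assms by (auto simp: frechet_derivative_works)

lemma Ck_on_local:
  assumes "\<And>x. x \<in> S \<Longrightarrow> \<exists>N. open N \<and> x \<in> N \<and> Ck_on k f N"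
  shows "Ck_on k f S"
  using assms
proof (induction k arbitrary: f)
  case 0
  have "isCont f x" if "x \<in> S" for x
    using 0[OF that] by (auto simp: continuous_on_eq_continuous_at)
  then show ?case by (simp add: continuous_at_imp_continuous_on)
next
  case (Suc k)
  have "\<exists>N. open N \<and> x \<in> N \<and> Ck_on k (\<lambda>y. frechet_derivative f (at y) u) N" if "x \<in> S" for x u
    using Suc.prems[OF that] unfolding Ck_on.simps(2) by blast
  then have "Ck_on k (\<lambda>y. frechet_derivative f (at y) u) S" for u by (rule Suc.IH)
  moreover have "f differentiable (at x)" if "x \<in> S" for x
    using Suc.prems[OF that] unfolding Ck_on.simps(2) by blast
  ultimately show ?case unfolding Ck_on.simps(2) by blast
qed

lemma Ck_on_const: "Ck_on k (\<lambda>x. c) S"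
  by (induction k arbitrary: c) auto

lemma Ck_on_bounded_linear:
  assumes "open S" "bounded_linear L" "Ck_on k f S"
  shows "Ck_on k (\<lambda>x. L (f x)) S"
  using assms(3)
proof (induction k arbitrary: f)
  case 0
  then show ?case
    using bounded_linear.continuous_on[OF assms(2)] by auto
next
  case (Suc k)
  show ?case
    by (rule Ck_on_SucI[OF assms(1) bounded_linear.has_derivative[OF assms(2) Ck_on_SucD(1)[OF Suc.prems]]])
      (auto intro: Suc.IH Ck_on_SucD(2)[OF Suc.prems])
qed

lemma Ck_on_ident:
  assumes "open S" shows "Ck_on k (\<lambda>x. x) S"
proof (cases k)
  case (Suc j)
  show ?thesis unfolding Suc
    by (rule Ck_on_SucI[OF assms has_derivative_ident]) (rule Ck_on_const)
qed auto

lemma Ck_on_add: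
  assumes "open S" "Ck_on k f S" "Ck_on k g S"
  shows "Ck_on k (\<lambda>x. f x + g x) S"
  using assms(2,3)
proof (induction k arbitrary: f g)
  case (Suc k)
  show ?case
    by (rule Ck_on_SucI[OF assms(1) has_derivative_add[OF Ck_on_SucD(1)[OF Suc.prems(1)] Ck_on_SucD(1)[OF Suc.prems(2)]]])
      (auto intro: Suc.IH Ck_on_SucD(2)[OF Suc.prems(1)] Ck_on_SucD(2)[OF Suc.prems(2)])
qed (auto intro: continuous_intros)

lemma Ck_on_bilinear:
  assumes "open S" "bounded_bilinear b" "Ck_on k f S" "Ck_on k g S"
  shows "Ck_on k (\<lambda>x. b (f x) (g x)) S"
  using assms(3,4)
proof (induction k arbitrary: f g)
  case 0
  then show ?case
    using bounded_bilinear.continuous_on[OF assms(2)] by auto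
next
  case (Suc k)
  show ?case
    by (rule Ck_on_SucI[OF assms(1) bounded_bilinear.FDERIV[OF assms(2)
          Ck_on_SucD(1)[OF Suc.prems(1)] Ck_on_SucD(1)[OF Suc.prems(2)]]])
      (auto intro!: Ck_on_add assms(1) Suc.IH Ck_on_SucD(2)[OF Suc.prems(1)] Ck_on_SucD(2)[OF Suc.prems(2)]
        Ck_on_Suc_imp[OF Suc.prems(1)] Ck_on_Suc_imp[OF Suc.prems(2)])
qed

lemma Ck_on_sum:
  assumes "open S" "\<And>i. i \<in> I \<Longrightarrow> Ck_on k (f i) S"
  shows "Ck_on k (\<lambda>x. \<Sum>i\<in>I. f i x) S"
  using assms(2)
  by (induction I rule: infinite_finite_induct) (auto intro!: Ck_on_add Ck_on_const assms(1))

lemma linear_basis_expansion: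
  assumes "linear L"
  shows "L (u::'e::euclidean_space) = (\<Sum>b\<in>Basis. (u \<bullet> b) *\<^sub>R L b)"
proof -
  have "L u = L (\<Sum>b\<in>Basis. (u \<bullet> b) *\<^sub>R b)" by (simp add: euclidean_representation)
  also have "\<dots> = (\<Sum>b\<in>Basis. (u \<bullet> b) *\<^sub>R L b)"
    using assms by (simp add: linear_sum linear_cmul)
  finally show ?thesis .
qed

text \<open>The induction goes over all outer functions: the chain rule, written in coordinates,
  expresses a derivative of \<open>f \<circ> g\<close> through compositions \<open>\<partial>\<^sub>b f \<circ> g\<close>, whose outer functions are
  partial derivatives of \<open>f\<close>.\<close>

lemma Ck_on_compose:
  fixes f :: "'e::euclidean_space \<Rightarrow> 'v::real_normed_vector"
    and g :: "'d::euclidean_space \<Rightarrow> 'e"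
  assumes "open S" "open T" "\<And>x. x \<in> S \<Longrightarrow> g x \<in> T" "Ck_on k f T" "Ck_on k g S"
  shows "Ck_on k (\<lambda>x. f (g x)) S"
  using assms(4,5)
proof (induction k arbitrary: f)
  case 0
  then show ?case using continuous_on_compose2[of T f S g] assms(3) by auto
next
  case (Suc k)
  have "Ck_on k (\<lambda>x. frechet_derivative f (at (g x)) (frechet_derivative g (at x) u)) S" for u
  proof (rule Ck_on_cong[OF assms(1)])
    show "(\<Sum>b\<in>Basis. (frechet_derivative g (at x) u \<bullet> b) *\<^sub>R frechet_derivative f (at (g x)) b)
        = frechet_derivative f (at (g x)) (frechet_derivative g (at x) u)" if "x \<in> S" for x
      using Suc.prems(1) assms(3)[OF that]
      by (intro linear_basis_expansion[symmetric] linear_frechet_derivative) auto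
    show "Ck_on k (\<lambda>x. \<Sum>b\<in>Basis. (frechet_derivative g (at x) u \<bullet> b) *\<^sub>R frechet_derivative f (at (g x)) b) S"
      using Suc.prems assms(1)
      by (intro Ck_on_sum Ck_on_bilinear[OF _ bounded_bilinear_scaleR] Suc.IH
          Ck_on_bounded_linear[OF _ bounded_linear_inner_left] Ck_on_SucD(2) Ck_on_Suc_imp[OF Suc.prems(2)])
  qed
  moreover have "((\<lambda>x. f (g x)) has_derivative
      (\<lambda>u. frechet_derivative f (at (g x)) (frechet_derivative g (at x) u))) (at x)" if "x \<in> S" for x
    by (rule has_derivative_compose[OF Ck_on_SucD(1)[OF Suc.prems(2) that]
          Ck_on_SucD(1)[OF Suc.prems(1) assms(3)[OF that]]])
  ultimately show ?case by (intro Ck_on_SucI[OF assms(1)])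
qed

lemma Ck_on_inverse:
  fixes f :: "'e::euclidean_space \<Rightarrow> real"
  assumes "open S" "\<And>x. x \<in> S \<Longrightarrow> f x \<noteq> 0" "Ck_on k f S"
  shows "Ck_on k (\<lambda>x. inverse (f x)) S"
  using assms(3)
proof (induction k)
  case 0
  then show ?case using assms(2) by (auto intro!: continuous_intros)
next
  case (Suc k)
  note * = Ck_on_bilinear[OF assms(1) bounded_bilinear_mult]
  show ?case
    by (rule Ck_on_SucI[OF assms(1) Deriv.has_derivative_inverse[OF assms(2) Ck_on_SucD(1)[OF Suc.prems]]])
      (assumption+, intro Ck_on_bounded_linear[OF assms(1) bounded_linear_minus[OF bounded_linear_ident]]
        * Suc.IH Ck_on_SucD(2)[OF Suc.prems] Ck_on_Suc_imp[OF Suc.prems])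
qed

lemma smooth_on_imp_has_derivative:
  "smooth_on S f \<Longrightarrow> x \<in> S \<Longrightarrow> (f has_derivative frechet_derivative f (at x)) (at x)"
  unfolding smooth_on_def by (rule Ck_on_SucD(1)) blast+

lemma smooth_on_frechet_derivative:
  "smooth_on S f \<Longrightarrow> smooth_on S (\<lambda>x. frechet_derivative f (at x) u)"
  unfolding smooth_on_def using Ck_on_SucD(2) by blast

lemma smooth_on_subset: "smooth_on S f \<Longrightarrow> T \<subseteq> S \<Longrightarrow> smooth_on T f"
  unfolding smooth_on_def using Ck_on_subset by blast

lemma smooth_on_cong: "smooth_on S f \<Longrightarrow> open S \<Longrightarrow> (\<And>x. x \<in> S \<Longrightarrow> f x = g x) \<Longrightarrow> smooth_on S g"
  unfolding smooth_on_def using Ck_on_cong by blast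

lemma smooth_on_local:
  "(\<And>x. x \<in> S \<Longrightarrow> \<exists>N. open N \<and> x \<in> N \<and> smooth_on N f) \<Longrightarrow> smooth_on S f"
  unfolding smooth_on_def by (intro allI Ck_on_local) blast

lemma smooth_on_const: "smooth_on S (\<lambda>x. c)"
  by (simp add: smooth_on_def Ck_on_const)

lemma smooth_on_ident: "open S \<Longrightarrow> smooth_on S (\<lambda>x. x)"
  by (simp add: smooth_on_def Ck_on_ident)

lemma smooth_on_bounded_linear:
  "bounded_linear L \<Longrightarrow> smooth_on S f \<Longrightarrow> open S \<Longrightarrow> smooth_on S (\<lambda>x. L (f x))"
  by (simp add: smooth_on_def Ck_on_bounded_linear)

lemma smooth_on_add:
  "smooth_on S f \<Longrightarrow> smooth_on S g \<Longrightarrow> open S \<Longrightarrow> smooth_on S (\<lambda>x. f x + g x)"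
  by (simp add: smooth_on_def Ck_on_add)

lemma smooth_on_diff:
  "smooth_on S f \<Longrightarrow> smooth_on S g \<Longrightarrow> open S \<Longrightarrow> smooth_on S (\<lambda>x. f x - g x)"
  using smooth_on_add[of S f "\<lambda>x. - g x"]
    smooth_on_bounded_linear[OF bounded_linear_minus[OF bounded_linear_ident], of S g] by simp

lemma smooth_on_scaleR:
  "smooth_on S f \<Longrightarrow> smooth_on S g \<Longrightarrow> open S \<Longrightarrow> smooth_on S (\<lambda>x. f x *\<^sub>R g x)"
  by (simp add: smooth_on_def Ck_on_bilinear[OF _ bounded_bilinear_scaleR])

lemma smooth_on_mult:
  fixes f g :: "_ \<Rightarrow> real"
  shows "smooth_on S f \<Longrightarrow> smooth_on S g \<Longrightarrow> open S \<Longrightarrow> smooth_on S (\<lambda>x. f x * g x)"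
  by (simp add: smooth_on_def Ck_on_bilinear[OF _ bounded_bilinear_mult])

lemma smooth_on_inner_left: "smooth_on S f \<Longrightarrow> open S \<Longrightarrow> smooth_on S (\<lambda>x. f x \<bullet> b)"
  by (rule smooth_on_bounded_linear[OF bounded_linear_inner_left])

lemma smooth_on_inner:
  "smooth_on S f \<Longrightarrow> smooth_on S g \<Longrightarrow> open S \<Longrightarrow> smooth_on S (\<lambda>x. f x \<bullet> g x)"
  by (simp add: smooth_on_def Ck_on_bilinear[OF _ bounded_bilinear_inner])

lemma smooth_on_sum:
  "(\<And>i. i \<in> I \<Longrightarrow> smooth_on S (f i)) \<Longrightarrow> open S \<Longrightarrow> smooth_on S (\<lambda>x. \<Sum>i\<in>I. f i x)"
  by (simp add: smooth_on_def Ck_on_sum)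

lemma smooth_on_compose:
  "smooth_on T f \<Longrightarrow> smooth_on S g \<Longrightarrow> open S \<Longrightarrow> open T \<Longrightarrow> (\<And>x. x \<in> S \<Longrightarrow> g x \<in> T) \<Longrightarrow>
   smooth_on S (\<lambda>x. f (g x))"
  by (simp add: smooth_on_def Ck_on_compose[of S T])

lemma smooth_on_divide:
  fixes f g :: "'e::euclidean_space \<Rightarrow> real"
  shows "smooth_on S f \<Longrightarrow> smooth_on S g \<Longrightarrow> open S \<Longrightarrow> (\<And>x. x \<in> S \<Longrightarrow> g x \<noteq> 0) \<Longrightarrow>
    smooth_on S (\<lambda>x. f x / g x)"
  unfolding divide_inverse
  by (rule smooth_on_mult) (auto simp: smooth_on_def Ck_on_inverse)

text \<open>Only derivatives in constant directions are smooth by definition; a variable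
  direction is expanded in the standard basis.\<close>

lemma smooth_on_frechet_derivative_apply:
  fixes f :: "'e::euclidean_space \<Rightarrow> 'v::real_normed_vector"
  assumes "smooth_on S f" "smooth_on S y" "open S"
  shows "smooth_on S (\<lambda>x. frechet_derivative f (at x) (y x))"
proof (rule smooth_on_cong)
  show "smooth_on S (\<lambda>x. \<Sum>b\<in>Basis. (y x \<bullet> b) *\<^sub>R frechet_derivative f (at x) b)"
    using assms by (intro smooth_on_sum smooth_on_scaleR smooth_on_inner_left smooth_on_frechet_derivative)
  show "(\<Sum>b\<in>Basis. (y x \<bullet> b) *\<^sub>R frechet_derivative f (at x) b) = frechet_derivative f (at x) (y x)"
    if "x \<in> S" for x
    using smooth_on_imp_has_derivative[OF assms(1) that]
    by (intro linear_basis_expansion[symmetric] has_derivative_linear)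
qed (rule assms)

section \<open>Bump functions on Euclidean space\<close>

text \<open>The functions \<open>exp (-1/t) / t\<^sup>n\<close>, continued by zero to \<open>t \<le> 0\<close>. The family is closed
  under differentiation up to linear combinations, which makes smoothness of all members a single
  induction.\<close>

definition flat_exp :: "nat \<Rightarrow> real \<Rightarrow> real" where
  "flat_exp n t = (if t \<le> 0 then 0 else exp (- inverse t) * inverse t ^ n)"

lemma power_over_fact_le_exp:
  fixes s :: real
  assumes "0 \<le> s"
  shows "s ^ n \<le> fact n * exp s"
proof -
  have "sum (\<lambda>k. s ^ k /\<^sub>R fact k) {n} \<le> suminf (\<lambda>k. s ^ k /\<^sub>R fact k)"
    by (rule sum_le_suminf) (use assms summable_exp_generic[of s] in auto)
  then have "s ^ n / fact n \<le> exp s" by (simp add: exp_def divide_inverse mult.commute)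
  then show ?thesis by (simp add: field_simps)
qed

text \<open>The exponential dominates the power \<open>n + 2\<close> of \<open>1/t\<close>; a quadratic bound is what
  makes the derivative at \<open>0\<close> vanish.\<close>

lemma flat_exp_bound: "\<bar>flat_exp n t\<bar> \<le> fact (n + 2) * t\<^sup>2"
proof (cases "t \<le> 0")
  case True
  then show ?thesis by (simp add: flat_exp_def)
next
  case False
  define s where "s = inverse t"
  have s: "s > 0" "s * t = 1" using False by (auto simp: s_def)
  have "exp (- s) * s ^ (n + 2) \<le> exp (- s) * (fact (n + 2) * exp s)"
    by (intro mult_left_mono power_over_fact_le_exp) (use s in auto)
  also have "\<dots> = fact (n + 2)" by (simp add: exp_minus)
  finally have "exp (- s) * s ^ (n + 2) * t\<^sup>2 \<le> fact (n + 2) * t\<^sup>2"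
    by (intro mult_right_mono) auto
  moreover have "exp (- s) * s ^ (n + 2) * t\<^sup>2 = exp (- s) * s ^ n * (s * t)\<^sup>2"
    by (simp add: power_mult_distrib power_add power2_eq_square)
  moreover have "\<bar>flat_exp n t\<bar> = exp (- s) * s ^ n"
    using False s(1) by (simp add: flat_exp_def s_def abs_mult)
  ultimately show ?thesis unfolding s(2) by (metis mult.right_neutral one_power2)
qed

lemma flat_exp_derivative:
  "(flat_exp n has_real_derivative flat_exp (n + 2) t - n * flat_exp (n + 1) t) (at t)"
proof -
  consider "t < 0" | "t = 0" | "t > 0" by linarith
  then show ?thesis
  proof cases
    case 1
    have "((\<lambda>t. 0) has_real_derivative 0) (at t)" by simp
    then have "(flat_exp n has_real_derivative 0) (at t)"
      by (rule has_field_derivative_transform_within_open[of _ _ _ "{..<0}"])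
        (use 1 in \<open>auto simp: flat_exp_def\<close>)
    then show ?thesis using 1 by (simp add: flat_exp_def)
  next
    case 2
    have "((\<lambda>h. flat_exp n h / h) \<longlongrightarrow> 0) (at 0)"
    proof (rule Lim_null_comparison)
      have "norm (flat_exp n h / h) \<le> fact (n + 2) * \<bar>h\<bar>" if "h \<noteq> 0" for h
      proof -
        have "\<bar>flat_exp n h\<bar> \<le> fact (n + 2) * \<bar>h\<bar> * \<bar>h\<bar>"
          using flat_exp_bound[of n h] by (simp add: power2_eq_square)
        then show ?thesis using that by (simp add: pos_divide_le_eq)
      qed
      then show "\<forall>\<^sub>F h in at 0. norm (flat_exp n h / h) \<le> fact (n + 2) * \<bar>h\<bar>"
        by (simp add: eventually_at_filter)
      show "((\<lambda>h::real. fact (n + 2) * \<bar>h\<bar>) \<longlongrightarrow> 0) (at 0)"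
        using tendsto_mult[OF tendsto_const tendsto_rabs[OF tendsto_ident_at], of "fact (n + 2)" 0 UNIV]
        by simp
    qed
    moreover have "flat_exp n 0 = 0" by (simp add: flat_exp_def)
    ultimately have "(flat_exp n has_real_derivative 0) (at 0)"
      unfolding DERIV_def by simp
    then show ?thesis using 2 by (simp add: flat_exp_def)
  next
    case 3
    have "((\<lambda>t. exp (- inverse t) * inverse t ^ n) has_real_derivative
        (flat_exp (n + 2) t - n * flat_exp (n + 1) t)) (at t)"
    proof -
      have "((\<lambda>t. exp (- inverse t) * inverse t ^ n) has_real_derivative
          exp (- inverse t) * (inverse t)\<^sup>2 * inverse t ^ n
          - exp (- inverse t) * (n * inverse t ^ (n - 1) * (inverse t)\<^sup>2)) (at t)"
        using 3 by (auto intro!: derivative_eq_intros simp: power2_eq_square)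
      also have "n * inverse t ^ (n - 1) * (inverse t)\<^sup>2 = n * inverse t ^ (n + 1)"
        by (cases n) (auto simp: power2_eq_square)
      finally show ?thesis
        using 3 by (simp add: flat_exp_def power2_eq_square algebra_simps)
    qed
    then show ?thesis
      by (rule has_field_derivative_transform_within_open[of _ _ _ "{0<..}"])
        (use 3 in \<open>auto simp: flat_exp_def\<close>)
  qed
qed

lemma smooth_flat_exp: "smooth_on UNIV (flat_exp n)"
proof -
  have "Ck_on k (flat_exp n) UNIV" for k
  proof (induction k arbitrary: n)
    case 0
    show ?case
      using DERIV_isCont[OF flat_exp_derivative] by (simp add: continuous_at_imp_continuous_on)
  next
    case (Suc k)
    show ?case
    proof (rule Ck_on_SucI)
      show "(flat_exp n has_derivative (\<lambda>u. u * (flat_exp (n + 2) t + (- n) * flat_exp (n + 1) t))) (at t)" for t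
        using flat_exp_derivative[of n t] by (simp add: has_field_derivative_def mult_commute_abs)
    qed (intro open_UNIV Ck_on_bilinear[OF _ bounded_bilinear_mult] Ck_on_const Ck_on_add Suc)+
  qed
  then show ?thesis by (simp add: smooth_on_def)
qed

text \<open>The quotient \<open>\<phi> / (\<phi> + \<psi>)\<close> of two flat functions, where \<open>\<phi>\<close> is positive exactly inside the
  outer ball and \<open>\<psi>\<close> exactly outside the closed inner ball, so that the denominator has no zero.\<close>

lemma bump_on_euclidean:
  fixes a :: "'e::euclidean_space"
  assumes "r > 0"
  obtains f :: "'e \<Rightarrow> real" where "smooth_on UNIV f"
    "\<And>x. x \<in> ball a (r/2) \<Longrightarrow> f x = 1" "\<And>x. x \<notin> cball a r \<Longrightarrow> f x = 0"
proof -
  define q where "q x = (x - a) \<bullet> (x - a)" for x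
  have q: "q x = (dist a x)\<^sup>2" for x
    unfolding q_def dist_norm norm_minus_commute[of a x] by (simp add: power2_norm_eq_inner)
  define \<phi> where "\<phi> x = flat_exp 0 (r\<^sup>2 - q x)" for x
  define \<psi> where "\<psi> x = flat_exp 0 (q x - (r/2)\<^sup>2)" for x
  have pos: "flat_exp 0 t \<ge> 0" "t > 0 \<Longrightarrow> flat_exp 0 t > 0" for t by (auto simp: flat_exp_def)
  have lt: "(r/2)\<^sup>2 < r\<^sup>2" using assms by (simp add: power2_eq_square)
  \<comment> \<open>Every point is inside the outer sphere or outside the inner one.\<close>
  have nz: "\<phi> x + \<psi> x > 0" for x
  proof (cases "q x < r\<^sup>2")
    case True
    then show ?thesis using pos[of "r\<^sup>2 - q x"] pos(1)[of "q x - (r/2)\<^sup>2"] by (simp add: \<phi>_def \<psi>_def)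
  next
    case False
    then have "q x - (r/2)\<^sup>2 > 0" using lt by linarith
    then show ?thesis using pos(1)[of "r\<^sup>2 - q x"] pos(2)[of "q x - (r/2)\<^sup>2"] by (simp add: \<phi>_def \<psi>_def)
  qed
  have sq: "smooth_on UNIV q"
    unfolding q_def by (intro smooth_on_inner smooth_on_diff smooth_on_ident smooth_on_const open_UNIV)
  have "smooth_on UNIV \<phi>" "smooth_on UNIV \<psi>"
    unfolding \<phi>_def \<psi>_def
    by (intro smooth_on_compose[OF smooth_flat_exp] smooth_on_diff sq smooth_on_const open_UNIV UNIV_I)+
  then have "smooth_on UNIV (\<lambda>x. \<phi> x / (\<phi> x + \<psi> x))"
    using nz by (intro smooth_on_divide smooth_on_add open_UNIV) (auto simp: less_imp_neq[symmetric])
  moreover have "\<phi> x / (\<phi> x + \<psi> x) = 1" if "x \<in> ball a (r/2)" for x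
  proof -
    have "q x < (r/2)\<^sup>2" unfolding q using that by (intro power_strict_mono) auto
    then have "\<psi> x = 0" by (simp add: \<psi>_def flat_exp_def)
    then show ?thesis using nz[of x] by simp
  qed
  moreover have "\<phi> x / (\<phi> x + \<psi> x) = 0" if "x \<notin> cball a r" for x
  proof -
    have "r\<^sup>2 < q x" unfolding q using that assms by (intro power_strict_mono) auto
    then show ?thesis by (simp add: \<phi>_def flat_exp_def)
  qed
  ultimately show ?thesis by (rule that)
qed

section \<open>Charts and smooth functions on manifolds\<close>

text \<open>Smoothness is stated relative to a subset because the components of a vector
  field in a chart are meaningful on the domain of that chart only. The values lie in an arbitrary
  normed space, so that the same notion serves for functions and for components of fields.\<close>

definition smooth_fun ::
  "('a, 'e::euclidean_space) atlas \<Rightarrow> 'a set \<Rightarrow> ('a \<Rightarrow> 'v::real_normed_vector) \<Rightarrow> bool" where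
  "smooth_fun A U f \<longleftrightarrow> (\<forall>c\<in>A. smooth_on (snd c ` (fst c \<inter> U)) (\<lambda>x. f (chart_inv c x)))"

text \<open>Linear combinations of tangent vectors are written with the pointwise operations
  \<open>tadd\<close> and \<open>tscale\<close>; this is the matching finite sum.\<close>

definition tsum :: "'i set \<Rightarrow> ('i \<Rightarrow> ('a, 'e::real_vector) tvec) \<Rightarrow> ('a, 'e) tvec" where
  "tsum I f = (\<lambda>c. \<Sum>i\<in>I. f i c)"

definition tlinear ::
  "('a, 'e::real_vector) tvec set \<Rightarrow> (('a, 'e) tvec \<Rightarrow> ('b, 'f::real_vector) tvec) \<Rightarrow> bool" where
  "tlinear V L \<longleftrightarrow> (\<forall>v\<in>V. \<forall>w\<in>V. L (tadd v w) = tadd (L v) (L w)) \<and>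
     (\<forall>a. \<forall>v\<in>V. L (tscale a v) = tscale a (L v))"

lemma tlinear_add: "tlinear V L \<Longrightarrow> v \<in> V \<Longrightarrow> w \<in> V \<Longrightarrow> L (tadd v w) = tadd (L v) (L w)"
  and tlinear_scale: "tlinear V L \<Longrightarrow> v \<in> V \<Longrightarrow> L (tscale a v) = tscale a (L v)"
  by (auto simp: tlinear_def)

lemma tscale_simps [simp]: "tscale 0 v = tzero" "tscale a tzero = tzero" "tscale 1 v = v"
  "tscale a (tscale b v) = tscale (a * b) v"
  by (auto simp: tscale_def tzero_def)

lemma tadd_simps [simp]: "tadd v tzero = v" "tadd tzero v = v"
  by (auto simp: tadd_def tzero_def)

lemma tsub_eq: "tsub v w = tadd v (tscale (-1) w)"
  by (simp add: tsub_def tadd_def tscale_def)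

lemma tadd_tsub: "tadd w (tsub v w) = v"
  by (simp add: tsub_def tadd_def)

lemma tsum_empty [simp]: "tsum {} f = tzero"
  by (simp add: tsum_def tzero_def)

lemma tsum_insert: "finite I \<Longrightarrow> i \<notin> I \<Longrightarrow> tsum (insert i I) f = tadd (f i) (tsum I f)"
  by (simp add: tsum_def tadd_def)

lemma tsum_apply: "tsum I f c = (\<Sum>i\<in>I. f i c)"
  by (simp add: tsum_def)

lemma tscale_apply: "tscale a v c = a *\<^sub>R v c"
  by (simp add: tscale_def)

lemma tadd_apply: "tadd v w c = v c + w c"
  by (simp add: tadd_def)

lemmas tapply = tsum_apply tscale_apply tadd_apply

locale smooth_manifold =
  fixes A :: "('a::{t2_space, second_countable_topology}, 'e::euclidean_space) atlas"
  assumes atlas: "smooth_atlas A"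
begin

lemma open_chart: "c \<in> A \<Longrightarrow> open (fst c)"
  and open_chart_range: "c \<in> A \<Longrightarrow> open (snd c ` fst c)"
  and chart_homeomorphism: "c \<in> A \<Longrightarrow> \<exists>\<psi>. homeomorphism (fst c) (snd c ` fst c) (snd c) \<psi>"
  and chart_cover: "\<exists>c\<in>A. p \<in> fst c"
  and smooth_transition:
    "c \<in> A \<Longrightarrow> d \<in> A \<Longrightarrow> smooth_on (snd c ` (fst c \<inter> fst d)) (\<lambda>x. snd d (chart_inv c x))"
  using atlas unfolding smooth_atlas_def comp_def by blast+

lemma chart_inv_left:
  assumes "c \<in> A" "p \<in> fst c"
  shows "chart_inv c (snd c p) = p"
proof -
  have "inj_on (snd c) (fst c)"
    using chart_homeomorphism[OF assms(1)] by (metis homeomorphism_def inj_on_inverseI)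
  then show ?thesis using assms(2) by (simp add: chart_inv_def)
qed

lemma chart_inv_right: "x \<in> snd c ` fst c \<Longrightarrow> snd c (chart_inv c x) = x"
  by (simp add: chart_inv_def f_inv_into_f)

lemma chart_continuous: "c \<in> A \<Longrightarrow> continuous_on (fst c) (snd c)"
  using chart_homeomorphism homeomorphism_cont1 by blast

lemma chart_inv_continuous:
  assumes "c \<in> A" shows "continuous_on (snd c ` fst c) (chart_inv c)"
proof -
  obtain \<psi> where \<psi>: "homeomorphism (fst c) (snd c ` fst c) (snd c) \<psi>"
    using chart_homeomorphism[OF assms] by blast
  have "chart_inv c x = \<psi> x" if "x \<in> snd c ` fst c" for x
    using that \<psi> chart_inv_left[OF assms] by (auto simp: homeomorphism_def)
  moreover have "continuous_on (snd c ` fst c) \<psi>" using \<psi> by (simp add: homeomorphism_def)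
  ultimately show ?thesis using continuous_on_cong[OF refl, of "snd c ` fst c" "chart_inv c" \<psi>] by simp
qed

lemma chart_image_eq:
  assumes "c \<in> A"
  shows "snd c ` (fst c \<inter> U) = {x \<in> snd c ` fst c. chart_inv c x \<in> U}"
  using chart_inv_left[OF assms] by force

lemma open_chart_image:
  assumes "c \<in> A" "open U"
  shows "open (snd c ` (fst c \<inter> U))"
proof -
  have "open ((snd c ` fst c) \<inter> chart_inv c -` U)"
    by (rule continuous_open_preimage[OF chart_inv_continuous open_chart_range]) (use assms in auto)
  moreover have "snd c ` (fst c \<inter> U) = (snd c ` fst c) \<inter> chart_inv c -` U"
    using chart_image_eq[OF assms(1)] by auto
  ultimately show ?thesis by simp
qed

lemma chart_imageE:
  assumes "c \<in> A" "x \<in> snd c ` (fst c \<inter> U)"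
  obtains p where "p \<in> fst c" "p \<in> U" "x = snd c p" "chart_inv c x = p"
  using assms chart_inv_left[OF assms(1)] by auto

lemma smooth_fun_subset: "smooth_fun A U f \<Longrightarrow> V \<subseteq> U \<Longrightarrow> smooth_fun A V f"
  unfolding smooth_fun_def by (blast intro: smooth_on_subset)

lemma smooth_fun_cong:
  assumes "smooth_fun A U f" "open U" "\<And>p. p \<in> U \<Longrightarrow> f p = g p"
  shows "smooth_fun A U g"
  unfolding smooth_fun_def
proof
  fix c assume c: "c \<in> A"
  show "smooth_on (snd c ` (fst c \<inter> U)) (\<lambda>x. g (chart_inv c x))"
  proof (rule smooth_on_cong[OF _ open_chart_image[OF c assms(2)]])
    show "smooth_on (snd c ` (fst c \<inter> U)) (\<lambda>x. f (chart_inv c x))"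
      using assms(1) c by (simp add: smooth_fun_def)
  qed (auto elim!: chart_imageE[OF c] simp: assms(3))
qed

lemma smooth_fun_local:
  assumes "\<And>p. p \<in> U \<Longrightarrow> \<exists>N. open N \<and> p \<in> N \<and> smooth_fun A N f"
  shows "smooth_fun A U f"
  unfolding smooth_fun_def
proof
  fix c assume c: "c \<in> A"
  show "smooth_on (snd c ` (fst c \<inter> U)) (\<lambda>x. f (chart_inv c x))"
  proof (rule smooth_on_local)
    fix x assume "x \<in> snd c ` (fst c \<inter> U)"
    then obtain p where p: "p \<in> fst c" "p \<in> U" "x = snd c p" by (rule chart_imageE[OF c])
    obtain N where N: "open N" "p \<in> N" "smooth_fun A N f" using assms p(2) by blast
    show "\<exists>N. open N \<and> x \<in> N \<and> smooth_on N (\<lambda>x. f (chart_inv c x))"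
      using open_chart_image[OF c N(1)] p N c unfolding smooth_fun_def by blast
  qed
qed

text \<open>Since transition maps are smooth, smoothness in one chart gives smoothness in every
  other chart.\<close>

lemma smooth_fun_from_chart:
  assumes d: "d \<in> A" and U: "open U" "U \<subseteq> fst d"
    and f: "smooth_on (snd d ` U) (\<lambda>x. f (chart_inv d x))"
  shows "smooth_fun A U f"
  unfolding smooth_fun_def
proof
  fix c assume c: "c \<in> A"
  let ?S = "snd c ` (fst c \<inter> U)"
  have S: "open ?S" using open_chart_image[OF c U(1)] .
  have "fst d \<inter> U = U" using U by auto
  then have T: "open (snd d ` U)" using open_chart_image[OF d U(1)] by simp
  have "smooth_on ?S (\<lambda>x. f (chart_inv d (snd d (chart_inv c x))))"
  proof (rule smooth_on_compose[OF f _ S T])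
    show "smooth_on ?S (\<lambda>x. snd d (chart_inv c x))"
      by (rule smooth_on_subset[OF smooth_transition[OF c d]]) (use U in auto)
  qed (auto elim!: chart_imageE[OF c])
  then show "smooth_on ?S (\<lambda>x. f (chart_inv c x))"
    by (rule smooth_on_cong[OF _ S]) (use U chart_inv_left[OF d] in \<open>auto elim!: chart_imageE[OF c]\<close>)
qed

lemma smooth_fun_const: "smooth_fun A U (\<lambda>p. c)"
  by (simp add: smooth_fun_def smooth_on_const)

lemma smooth_fun_add:
  "smooth_fun A U f \<Longrightarrow> smooth_fun A U g \<Longrightarrow> open U \<Longrightarrow> smooth_fun A U (\<lambda>p. f p + g p)"
  by (simp add: smooth_fun_def smooth_on_add open_chart_image)

lemma smooth_fun_diff:
  "smooth_fun A U f \<Longrightarrow> smooth_fun A U g \<Longrightarrow> open U \<Longrightarrow> smooth_fun A U (\<lambda>p. f p - g p)"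
  by (simp add: smooth_fun_def smooth_on_diff open_chart_image)

lemma smooth_fun_scaleR:
  "smooth_fun A U f \<Longrightarrow> smooth_fun A U g \<Longrightarrow> open U \<Longrightarrow> smooth_fun A U (\<lambda>p. f p *\<^sub>R g p)"
  by (simp add: smooth_fun_def smooth_on_scaleR open_chart_image)

lemma smooth_fun_mult:
  fixes f g :: "'a \<Rightarrow> real"
  shows "smooth_fun A U f \<Longrightarrow> smooth_fun A U g \<Longrightarrow> open U \<Longrightarrow> smooth_fun A U (\<lambda>p. f p * g p)"
  by (simp add: smooth_fun_def smooth_on_mult open_chart_image)

lemma smooth_fun_divide:
  fixes f g :: "'a \<Rightarrow> real"
  assumes "smooth_fun A U f" "smooth_fun A U g" "open U" "\<And>p. p \<in> U \<Longrightarrow> g p \<noteq> 0"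
  shows "smooth_fun A U (\<lambda>p. f p / g p)"
  unfolding smooth_fun_def
proof
  fix c assume c: "c \<in> A"
  show "smooth_on (snd c ` (fst c \<inter> U)) (\<lambda>x. f (chart_inv c x) / g (chart_inv c x))"
    by (rule smooth_on_divide)
      (use assms c in \<open>auto simp: smooth_fun_def open_chart_image elim!: chart_imageE[OF c]\<close>)
qed

lemma smooth_fun_inner_left:
  "smooth_fun A U f \<Longrightarrow> open U \<Longrightarrow> smooth_fun A U (\<lambda>p. f p \<bullet> b)"
  by (simp add: smooth_fun_def smooth_on_inner_left open_chart_image)

lemma smooth_fun_sum:
  "(\<And>i. i \<in> I \<Longrightarrow> smooth_fun A U (f i)) \<Longrightarrow> open U \<Longrightarrow> smooth_fun A U (\<lambda>p. \<Sum>i\<in>I. f i p)"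
  by (simp add: smooth_fun_def smooth_on_sum open_chart_image)

lemma smooth_fun_compose:
  fixes f :: "'a \<Rightarrow> 'd::euclidean_space"
  assumes "smooth_on V h" "open V" "smooth_fun A U f" "open U" "\<And>p. p \<in> U \<Longrightarrow> f p \<in> V"
  shows "smooth_fun A U (\<lambda>p. h (f p))"
  unfolding smooth_fun_def
proof
  fix c assume c: "c \<in> A"
  show "smooth_on (snd c ` (fst c \<inter> U)) (\<lambda>x. h (f (chart_inv c x)))"
    by (rule smooth_on_compose[OF assms(1) _ open_chart_image[OF c assms(4)] assms(2)])
      (use assms(3,5) c in \<open>auto simp: smooth_fun_def elim!: chart_imageE[OF c]\<close>)
qed

lemma smooth_fun_chart:
  assumes "d \<in> A" shows "smooth_fun A (fst d) (snd d)"
proof (rule smooth_fun_from_chart[OF assms open_chart[OF assms] order_refl])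
  show "smooth_on (snd d ` fst d) (\<lambda>x. snd d (chart_inv d x))"
    using open_chart_range[OF assms]
    by (rule smooth_on_cong[OF smooth_on_ident]) (auto simp: assms chart_inv_right open_chart_range)
qed

lemma smooth_function_iff: "smooth_function A f \<longleftrightarrow> smooth_fun A UNIV f"
  by (simp add: smooth_function_def smooth_fun_def comp_def)

section \<open>Tangent vectors\<close>

abbreviation jac where
  "jac c d p \<equiv> frechet_derivative (snd d \<circ> chart_inv c) (at (snd c p))"

lemma jac_has_derivative:
  assumes "c \<in> A" "d \<in> A" "p \<in> fst c" "p \<in> fst d"
  shows "((\<lambda>x. snd d (chart_inv c x)) has_derivative jac c d p) (at (snd c p))"
  unfolding comp_def
  by (rule smooth_on_imp_has_derivative[OF smooth_transition[OF assms(1,2)]]) (use assms in auto)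

lemma linear_jac:
  assumes "c \<in> A" "d \<in> A" "p \<in> fst c" "p \<in> fst d"
  shows "linear (jac c d p)"
  using jac_has_derivative[OF assms] by (rule has_derivative_linear)

text \<open>Chain rule for a change of coordinates. All independence of the chart, of tangent
  vectors and of directional derivatives, comes down to it.\<close>

lemma has_derivative_chart_change:
  assumes c: "c \<in> A" "p \<in> fst c" and d: "d \<in> A" "p \<in> fst d"
    and f: "((\<lambda>x. f (chart_inv d x)) has_derivative F) (at (snd d p))"
  shows "((\<lambda>x. f (chart_inv c x)) has_derivative (\<lambda>u. F (jac c d p u))) (at (snd c p))"
proof -
  have "((\<lambda>x. f (chart_inv d (snd d (chart_inv c x)))) has_derivative (\<lambda>u. F (jac c d p u))) (at (snd c p))"
    by (rule has_derivative_compose[OF jac_has_derivative[OF c(1) d(1) c(2) d(2)]])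
      (use f c d in \<open>simp add: chart_inv_left\<close>)
  then show ?thesis
    by (rule has_derivative_transform_within_open[OF _ open_chart_image[OF c(1) open_chart[OF d(1)]]])
      (use c d chart_inv_left[OF d(1)] in \<open>auto elim!: chart_imageE[OF c(1)]\<close>)
qed

lemma jac_chain:
  assumes "c \<in> A" "p \<in> fst c" "d \<in> A" "p \<in> fst d" "e \<in> A" "p \<in> fst e"
  shows "jac c e p u = jac d e p (jac c d p u)"
  using frechet_derivative_at[OF has_derivative_chart_change[OF assms(1-4)
        jac_has_derivative[OF assms(3,5,4,6)]]]
  by (simp add: comp_def fun_eq_iff)

lemma jac_same:
  assumes "c \<in> A" "p \<in> fst c"
  shows "jac c c p u = u"
proof -
  have "((\<lambda>x. snd c (chart_inv c x)) has_derivative (\<lambda>u. u)) (at (snd c p))"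
    by (rule has_derivative_transform_within_open[OF has_derivative_ident open_chart_range[OF assms(1)]])
      (use assms in \<open>auto simp: chart_inv_left\<close>)
  from frechet_derivative_at[OF this] show ?thesis by (simp add: comp_def fun_eq_iff)
qed

lemma tangent_change:
  "v \<in> tangent_space A p \<Longrightarrow> c \<in> A \<Longrightarrow> d \<in> A \<Longrightarrow> p \<in> fst c \<Longrightarrow> p \<in> fst d \<Longrightarrow> v d = jac c d p (v c)"
  unfolding tangent_space_def by blast

lemma tangent_outside: "v \<in> tangent_space A p \<Longrightarrow> \<not> (c \<in> A \<and> p \<in> fst c) \<Longrightarrow> v c = 0"
  unfolding tangent_space_def by blast

lemma tangentI:
  assumes "\<And>c d. c \<in> A \<Longrightarrow> d \<in> A \<Longrightarrow> p \<in> fst c \<Longrightarrow> p \<in> fst d \<Longrightarrow> v d = jac c d p (v c)"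
    and "\<And>c. \<not> (c \<in> A \<and> p \<in> fst c) \<Longrightarrow> v c = 0"
  shows "v \<in> tangent_space A p"
  unfolding tangent_space_def using assms by blast

lemma tangent_eqI:
  assumes "v \<in> tangent_space A p" "w \<in> tangent_space A p" "c \<in> A" "p \<in> fst c" "v c = w c"
  shows "v = w"
proof
  fix d
  show "v d = w d"
    using tangent_change[OF assms(1,3) _ assms(4), of d] tangent_change[OF assms(2,3) _ assms(4), of d]
     tangent_outside[OF assms(1), of d] tangent_outside[OF assms(2), of d] assms(5)
    by (cases "d \<in> A \<and> p \<in> fst d") auto
qed

lemma coord_vec_in: "c \<in> A \<Longrightarrow> p \<in> fst c \<Longrightarrow> coord_vec A c p u \<in> tangent_space A p"
  by (rule tangentI) (auto simp: coord_vec_def intro: jac_chain)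

lemma coord_vec_same: "c \<in> A \<Longrightarrow> p \<in> fst c \<Longrightarrow> coord_vec A c p u c = u"
  by (simp add: coord_vec_def jac_same)

lemma coord_vec_eq: "v \<in> tangent_space A p \<Longrightarrow> c \<in> A \<Longrightarrow> p \<in> fst c \<Longrightarrow> coord_vec A c p (v c) = v"
  by (rule tangent_eqI) (auto intro: coord_vec_in simp: coord_vec_same)

lemma tangent_add: "v \<in> tangent_space A p \<Longrightarrow> w \<in> tangent_space A p \<Longrightarrow> tadd v w \<in> tangent_space A p"
  by (rule tangentI)
    (simp_all add: tadd_def linear_add[OF linear_jac] tangent_outside flip: tangent_change)

lemma tangent_scale: "v \<in> tangent_space A p \<Longrightarrow> tscale a v \<in> tangent_space A p"
  by (rule tangentI)
    (simp_all add: tscale_def linear_cmul[OF linear_jac] tangent_outside flip: tangent_change)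

lemma tangent_zero: "tzero \<in> tangent_space A p"
  by (rule tangentI) (simp_all add: tzero_def linear_0[OF linear_jac])

lemma tangent_sum: "(\<And>i. i \<in> I \<Longrightarrow> f i \<in> tangent_space A p) \<Longrightarrow> tsum I f \<in> tangent_space A p"
proof (induction I rule: infinite_finite_induct)
  case (infinite I)
  then have "tsum I f = tzero" by (simp add: tsum_def tzero_def)
  then show ?case by (simp add: tangent_zero)
qed (auto simp: tsum_insert tangent_add tangent_zero)

lemma tangent_sub: "v \<in> tangent_space A p \<Longrightarrow> w \<in> tangent_space A p \<Longrightarrow> tsub v w \<in> tangent_space A p"
  by (simp add: tsub_eq tangent_add tangent_scale)

lemma tlinear_zero: "tlinear (tangent_space A p) L \<Longrightarrow> L tzero = tzero"
  using tlinear_scale[of "tangent_space A p" L tzero 0] tangent_zero by simp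

lemma tlinear_sum:
  assumes L: "tlinear (tangent_space A p) L" and "finite I" "\<And>i. i \<in> I \<Longrightarrow> f i \<in> tangent_space A p"
  shows "L (tsum I f) = tsum I (\<lambda>i. L (f i))"
  using assms(2,3)
proof (induction I rule: finite_induct)
  case empty
  then show ?case by (simp add: tlinear_zero[OF L])
next
  case (insert i I)
  then show ?case by (simp add: tsum_insert tlinear_add[OF L] tangent_sum)
qed

lemma tangent_expansion:
  assumes "v \<in> tangent_space A p" "c \<in> A" "p \<in> fst c"
  shows "v = tsum Basis (\<lambda>b. tscale (v c \<bullet> b) (coord_vec A c p b))"
  by (rule tangent_eqI[OF assms(1) _ assms(2,3)])
    (auto intro!: tangent_sum tangent_scale coord_vec_in assms
      simp: tapply coord_vec_same[OF assms(2,3)] euclidean_representation)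

section \<open>Derivatives along tangent vectors\<close>

lemma smooth_fun_has_derivative:
  assumes "smooth_fun A U f" "c \<in> A" "p \<in> fst c" "p \<in> U"
  shows "((\<lambda>x. f (chart_inv c x)) has_derivative frechet_derivative (\<lambda>x. f (chart_inv c x)) (at (snd c p))) (at (snd c p))"
  by (rule smooth_on_imp_has_derivative[of "snd c ` (fst c \<inter> U)"])
    (use assms in \<open>auto simp: smooth_fun_def\<close>)

text \<open>\<open>tderiv\<close> is defined through a chosen chart; by the transformation rule of tangent
  vectors any other chart gives the same value.\<close>

lemma tderiv_eq:
  assumes v: "v \<in> tangent_space A p" and c: "c \<in> A" "p \<in> fst c"
    and f: "((\<lambda>x. f (chart_inv c x)) has_derivative F) (at (snd c p))"
  shows "tderiv A p v f = F (v c)"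
proof -
  define d where "d = chart_at A p"
  have d: "d \<in> A" "p \<in> fst d"
    using chart_cover[of p] someI_ex[of "\<lambda>c. c \<in> A \<and> p \<in> fst c"] unfolding d_def chart_at_def by blast+
  have "((\<lambda>x. f (chart_inv d x)) has_derivative (\<lambda>u. F (jac d c p u))) (at (snd d p))"
    by (rule has_derivative_chart_change[OF d c f])
  from frechet_derivative_at[OF this] have "tderiv A p v f = F (jac d c p (v d))"
    by (simp add: tderiv_def Let_def d_def comp_def fun_eq_iff)
  then show ?thesis using tangent_change[OF v d(1) c(1) d(2) c(2)] by simp
qed

lemma tderiv_smooth:
  assumes "smooth_fun A U f" "v \<in> tangent_space A p" "c \<in> A" "p \<in> fst c" "p \<in> U"
  shows "tderiv A p v f = frechet_derivative (\<lambda>x. f (chart_inv c x)) (at (snd c p)) (v c)"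
  by (rule tderiv_eq[OF assms(2-4) smooth_fun_has_derivative[OF assms(1,3-5)]])

lemma tderiv_cong:
  assumes "smooth_fun A U f" "open U" "p \<in> U" "v \<in> tangent_space A p" "\<And>q. q \<in> U \<Longrightarrow> f q = g q"
  shows "tderiv A p v g = tderiv A p v f"
proof -
  obtain c where c: "c \<in> A" "p \<in> fst c" using chart_cover by blast
  have "((\<lambda>x. g (chart_inv c x)) has_derivative frechet_derivative (\<lambda>x. f (chart_inv c x)) (at (snd c p))) (at (snd c p))"
    by (rule has_derivative_transform_within_open[OF smooth_fun_has_derivative[OF assms(1) c assms(3)]
          open_chart_image[OF c(1) assms(2)]])
      (use c assms(3,5) in \<open>auto elim!: chart_imageE[OF c(1)]\<close>)
  from tderiv_eq[OF assms(4) c this] show ?thesis using tderiv_smooth[OF assms(1,4) c assms(3)] by simp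
qed

lemma tderiv_const: "v \<in> tangent_space A p \<Longrightarrow> tderiv A p v (\<lambda>q. k) = 0"
  using chart_cover[of p] tderiv_eq[OF _ _ _ has_derivative_const] by blast

lemma tderiv_sum_scaleR:
  assumes "\<And>i. i \<in> I \<Longrightarrow> smooth_fun A U (a i)" "\<And>i. i \<in> I \<Longrightarrow> smooth_fun A U (e i)" "p \<in> U"
    and v: "v \<in> tangent_space A p"
  shows "tderiv A p v (\<lambda>q. \<Sum>i\<in>I. a i q *\<^sub>R e i q) =
    (\<Sum>i\<in>I. tderiv A p v (a i) *\<^sub>R e i p + a i p *\<^sub>R tderiv A p v (e i))"
proof -
  obtain c where c: "c \<in> A" "p \<in> fst c" using chart_cover by blast
  define da where "da i = frechet_derivative (\<lambda>x. a i (chart_inv c x)) (at (snd c p))" for i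
  define de where "de i = frechet_derivative (\<lambda>x. e i (chart_inv c x)) (at (snd c p))" for i
  have "((\<lambda>x. \<Sum>i\<in>I. a i (chart_inv c x) *\<^sub>R e i (chart_inv c x)) has_derivative
      (\<lambda>u. \<Sum>i\<in>I. a i (chart_inv c (snd c p)) *\<^sub>R de i u + da i u *\<^sub>R e i (chart_inv c (snd c p)))) (at (snd c p))"
    unfolding da_def de_def
    by (intro has_derivative_sum has_derivative_scaleR smooth_fun_has_derivative[OF assms(1) c assms(3)]
        smooth_fun_has_derivative[OF assms(2) c assms(3)])
  from tderiv_eq[OF v c this] show ?thesis
    using tderiv_smooth[OF assms(1) v c assms(3)] tderiv_smooth[OF assms(2) v c assms(3)]
    by (simp add: chart_inv_left[OF c] da_def de_def add.commute)
qed

lemma tderiv_linear: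
  assumes "smooth_fun A U f" "p \<in> U" "v \<in> tangent_space A p" "w \<in> tangent_space A p"
  shows "tderiv A p (tadd v w) f = tderiv A p v f + tderiv A p w f"
    and "tderiv A p (tscale r v) f = r *\<^sub>R tderiv A p v f"
proof -
  obtain c where c: "c \<in> A" "p \<in> fst c" using chart_cover by blast
  have "linear (frechet_derivative (\<lambda>x. f (chart_inv c x)) (at (snd c p)))"
    using smooth_fun_has_derivative[OF assms(1) c assms(2)] by (rule has_derivative_linear)
  then show "tderiv A p (tadd v w) f = tderiv A p v f + tderiv A p w f"
    and "tderiv A p (tscale r v) f = r *\<^sub>R tderiv A p v f"
    using assms tderiv_smooth[OF assms(1) _ c assms(2)]
    by (simp_all add: tangent_add tangent_scale tadd_apply tscale_apply linear_add linear_cmul)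
qed

section \<open>Vector fields\<close>

text \<open>The components in each chart are smooth functions on the manifold itself, and so
  the calculus of \<open>smooth_fun\<close> applies to them without passing to coordinates.\<close>

lemma vector_field_on_iff:
  assumes "open U"
  shows "vector_field_on A U X \<longleftrightarrow>
    (\<forall>p\<in>U. X p \<in> tangent_space A p) \<and> (\<forall>c\<in>A. smooth_fun A (fst c \<inter> U) (\<lambda>p. X p c))"
proof -
  have "smooth_on (snd c ` (fst c \<inter> U)) (\<lambda>x. X (chart_inv c x) c) \<longleftrightarrow>
      smooth_fun A (fst c \<inter> U) (\<lambda>p. X p c)" if c: "c \<in> A" for c
  proof
    assume "smooth_on (snd c ` (fst c \<inter> U)) (\<lambda>x. X (chart_inv c x) c)"
    then show "smooth_fun A (fst c \<inter> U) (\<lambda>p. X p c)"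
      using assms open_chart[OF c] by (intro smooth_fun_from_chart[OF c]) auto
  next
    assume "smooth_fun A (fst c \<inter> U) (\<lambda>p. X p c)"
    then show "smooth_on (snd c ` (fst c \<inter> U)) (\<lambda>x. X (chart_inv c x) c)"
      using c by (auto simp: smooth_fun_def simp flip: Int_assoc)
  qed
  then show ?thesis by (simp add: vector_field_on_def)
qed

lemma vector_fields_iff:
  "X \<in> vector_fields A \<longleftrightarrow> (\<forall>p. X p \<in> tangent_space A p) \<and> (\<forall>c\<in>A. smooth_fun A (fst c) (\<lambda>p. X p c))"
  by (simp add: vector_fields_def vector_field_on_iff)

lemma vector_field_tangent: "X \<in> vector_fields A \<Longrightarrow> X p \<in> tangent_space A p"
  and vector_field_smooth: "X \<in> vector_fields A \<Longrightarrow> c \<in> A \<Longrightarrow> smooth_fun A (fst c) (\<lambda>p. X p c)"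
  by (simp_all add: vector_fields_iff)

lemma smooth_tderiv:
  assumes X: "X \<in> vector_fields A" and U: "open U" and f: "smooth_fun A U f"
  shows "smooth_fun A U (\<lambda>p. tderiv A p (X p) f)"
proof (rule smooth_fun_local)
  fix p assume p: "p \<in> U"
  obtain c where c: "c \<in> A" "p \<in> fst c" using chart_cover by blast
  let ?N = "fst c \<inter> U"
  have N: "open ?N" using U open_chart[OF c(1)] by auto
  have "smooth_fun A ?N (\<lambda>p. tderiv A p (X p) f)"
  proof (rule smooth_fun_from_chart[OF c(1) N])
    have "smooth_on (snd c ` ?N) (\<lambda>x. frechet_derivative (\<lambda>x. f (chart_inv c x)) (at x) (X (chart_inv c x) c))"
    proof (rule smooth_on_frechet_derivative_apply[OF _ _ open_chart_image[OF c(1) U]])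
      show "smooth_on (snd c ` ?N) (\<lambda>x. f (chart_inv c x))"
        using f c by (simp add: smooth_fun_def)
      show "smooth_on (snd c ` ?N) (\<lambda>x. X (chart_inv c x) c)"
        by (rule smooth_on_subset[of "snd c ` (fst c \<inter> fst c)"])
          (use vector_field_smooth[OF X c(1)] c in \<open>auto simp: smooth_fun_def\<close>)
    qed
    then show "smooth_on (snd c ` ?N) (\<lambda>x. tderiv A (chart_inv c x) (X (chart_inv c x)) f)"
      by (rule smooth_on_cong[OF _ open_chart_image[OF c(1) U]])
        (auto elim!: chart_imageE[OF c(1)] simp: tderiv_smooth[OF f vector_field_tangent[OF X] c(1)])
  qed auto
  then show "\<exists>N. open N \<and> p \<in> N \<and> smooth_fun A N (\<lambda>p. tderiv A p (X p) f)"
    using N p c by blast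
qed

end

section \<open>Cut-off functions and local frames\<close>

context smooth_manifold begin

text \<open>A Euclidean bump is transported by a chart. Its support is the image of a closed
  ball, hence compact, hence closed because the manifold is Hausdorff; this is what makes the extension
  by zero smooth.\<close>

lemma bump_function:
  assumes "open U" "q \<in> U"
  obtains \<Phi> :: "'a \<Rightarrow> real" and K N where "smooth_fun A UNIV \<Phi>" "closed K" "K \<subseteq> U"
    "\<And>p. p \<notin> K \<Longrightarrow> \<Phi> p = 0" "open N" "q \<in> N" "N \<subseteq> U" "\<And>p. p \<in> N \<Longrightarrow> \<Phi> p = 1"
proof -
  obtain c where c: "c \<in> A" "q \<in> fst c" using chart_cover by blast
  let ?V = "snd c ` (fst c \<inter> U)"
  have "open ?V" "snd c q \<in> ?V" using open_chart_image[OF c(1) assms(1)] c assms(2) by auto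
  then obtain r where r: "r > 0" "cball (snd c q) r \<subseteq> ?V" by (meson open_contains_cball)
  obtain f :: "'e \<Rightarrow> real" where f: "smooth_on UNIV f"
    "\<And>x. x \<in> ball (snd c q) (r/2) \<Longrightarrow> f x = 1" "\<And>x. x \<notin> cball (snd c q) r \<Longrightarrow> f x = 0"
    using bump_on_euclidean[OF r(1)] by blast
  define \<Phi> where "\<Phi> p = (if p \<in> fst c then f (snd c p) else 0)" for p
  define K where "K = chart_inv c ` cball (snd c q) r"
  define N where "N = fst c \<inter> snd c -` ball (snd c q) (r/2)"
  have KU: "K \<subseteq> U \<inter> fst c"
  proof
    fix p assume "p \<in> K"
    then obtain x where "x \<in> ?V" "p = chart_inv c x" unfolding K_def using r(2) by blast
    then show "p \<in> U \<inter> fst c" by (auto elim!: chart_imageE[OF c(1)])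
  qed
  have "compact K" unfolding K_def
    by (intro compact_continuous_image continuous_on_subset[OF chart_inv_continuous[OF c(1)]] compact_cball)
      (use r in auto)
  then have K: "closed K" by (rule compact_imp_closed)
  have off: "\<Phi> p = 0" if "p \<notin> K" for p
  proof (cases "p \<in> fst c")
    case True
    then have "snd c p \<notin> cball (snd c q) r"
      using that chart_inv_left[OF c(1) True] unfolding K_def by (metis imageI)
    then show ?thesis using f(3) by (simp add: \<Phi>_def)
  qed (simp add: \<Phi>_def)
  have N: "open N" unfolding N_def
    by (rule continuous_open_preimage[OF chart_continuous open_chart]) (use c in auto)
  have "N \<subseteq> U"
  proof
    fix p assume p: "p \<in> N"
    then have "snd c p \<in> cball (snd c q) r" using r by (auto simp: N_def)
    then have "p \<in> K" using chart_inv_left[OF c(1)] p unfolding K_def N_def by (metis IntD1 imageI)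
    then show "p \<in> U" using KU by auto
  qed
  moreover have "smooth_fun A UNIV \<Phi>"
  proof (rule smooth_fun_local)
    fix p
    show "\<exists>N. open N \<and> p \<in> N \<and> smooth_fun A N \<Phi>"
    proof (cases "p \<in> fst c")
      case True
      have "smooth_fun A (fst c) (\<lambda>p. f (snd c p))"
        by (rule smooth_fun_compose[OF f(1) open_UNIV smooth_fun_chart open_chart]) (use c in auto)
      then have "smooth_fun A (fst c) \<Phi>"
        by (rule smooth_fun_cong) (use c open_chart in \<open>auto simp: \<Phi>_def\<close>)
      then show ?thesis using True open_chart[OF c(1)] by blast
    next
      case False
      have "smooth_fun A (- K) \<Phi>"
        by (rule smooth_fun_cong[OF smooth_fun_const[of _ 0]]) (use K off in auto)
      then show ?thesis using False KU K by blast
    qed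
  qed
  moreover have "q \<in> N" using c r by (simp add: N_def)
  moreover have "\<Phi> p = 1" if "p \<in> N" for p using that f(2) by (simp add: \<Phi>_def N_def)
  ultimately show ?thesis using that K KU off N by blast
qed

lemma cutoff_fun:
  assumes "open U" "smooth_fun A U f" "smooth_fun A UNIV \<Phi>" "closed K" "K \<subseteq> U"
    and "\<And>p. p \<notin> K \<Longrightarrow> \<Phi> p = 0" "open W"
  shows "smooth_fun A W (\<lambda>p. \<Phi> p *\<^sub>R f p)"
proof (rule smooth_fun_local)
  fix p
  show "\<exists>N. open N \<and> p \<in> N \<and> smooth_fun A N (\<lambda>p. \<Phi> p *\<^sub>R f p)"
  proof (cases "p \<in> U")
    case True
    have "smooth_fun A U (\<lambda>p. \<Phi> p *\<^sub>R f p)"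
      by (intro smooth_fun_scaleR smooth_fun_subset[OF assms(3)] assms) auto
    then show ?thesis using True assms(1) by blast
  next
    case False
    have "smooth_fun A (- K) (\<lambda>p. \<Phi> p *\<^sub>R f p)"
      by (rule smooth_fun_cong[OF smooth_fun_const[of _ 0]]) (use assms in auto)
    then show ?thesis using False assms(4,5) by blast
  qed
qed

text \<open>Multiplication by a cut-off function turns local fields into global ones, on which
  connections can act.\<close>

lemma cutoff_field:
  assumes U: "open U" and X: "vector_field_on A U X"
    and \<Phi>: "smooth_fun A UNIV \<Phi>" "closed K" "K \<subseteq> U" "\<And>p. p \<notin> K \<Longrightarrow> \<Phi> p = 0"
  shows "(\<lambda>p. tscale (\<Phi> p) (X p)) \<in> vector_fields A"
  unfolding vector_fields_iff
proof (intro conjI allI ballI)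
  fix p
  show "tscale (\<Phi> p) (X p) \<in> tangent_space A p"
  proof (cases "p \<in> U")
    case True
    then show ?thesis using X by (simp add: vector_field_on_def tangent_scale)
  next
    case False
    then have "\<Phi> p = 0" using \<Phi>(3,4) by blast
    then show ?thesis by (simp add: tangent_zero)
  qed
next
  fix c assume c: "c \<in> A"
  show "smooth_fun A (fst c) (\<lambda>p. tscale (\<Phi> p) (X p) c)"
    unfolding tscale_apply
  proof (rule smooth_fun_local)
    fix p assume p: "p \<in> fst c"
    show "\<exists>N. open N \<and> p \<in> N \<and> smooth_fun A N (\<lambda>p. \<Phi> p *\<^sub>R X p c)"
    proof (cases "p \<in> U")
      case True
      have "smooth_fun A (fst c \<inter> U) (\<lambda>p. \<Phi> p *\<^sub>R X p c)"
        using X U c open_chart[OF c]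
        by (intro smooth_fun_scaleR smooth_fun_subset[OF \<Phi>(1)]) (auto simp: vector_field_on_iff)
      then show ?thesis using True U p open_chart[OF c] by blast
    next
      case False
      have "smooth_fun A (- K) (\<lambda>p. \<Phi> p *\<^sub>R X p c)"
        by (rule smooth_fun_cong[OF smooth_fun_const[of _ 0]]) (use \<Phi> in auto)
      then show ?thesis using False \<Phi>(2,3) by blast
    qed
  qed
qed

lemma coord_field:
  assumes d: "d \<in> A"
  shows "vector_field_on A (fst d) (\<lambda>p. coord_vec A d p u)"
  unfolding vector_field_on_iff[OF open_chart[OF d]]
proof (intro conjI ballI)
  fix c assume c: "c \<in> A"
  let ?U = "fst c \<inter> fst d"
  have dU: "fst d \<inter> ?U = ?U" by auto
  have U: "open ?U" using open_chart[OF c] open_chart[OF d] by auto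
  have S: "open (snd d ` ?U)" using open_chart_image[OF d U] dU by simp
  show "smooth_fun A ?U (\<lambda>p. coord_vec A d p u c)"
  proof (rule smooth_fun_from_chart[OF d U])
    have "smooth_on (snd d ` ?U) (\<lambda>x. snd c (chart_inv d x))"
      using smooth_transition[OF d c] by (simp add: Int_commute)
    then have "smooth_on (snd d ` ?U) (\<lambda>x. frechet_derivative (\<lambda>x. snd c (chart_inv d x)) (at x) u)"
      by (rule smooth_on_frechet_derivative)
    then show "smooth_on (snd d ` ?U) (\<lambda>x. coord_vec A d (chart_inv d x) u c)"
      by (rule smooth_on_cong[OF _ S]) (use c chart_inv_left[OF d] in \<open>auto simp: coord_vec_def comp_def\<close>)
  qed auto
qed (auto intro: coord_vec_in d)

lemma vector_field_add:
  "X \<in> vector_fields A \<Longrightarrow> Y \<in> vector_fields A \<Longrightarrow> (\<lambda>p. tadd (X p) (Y p)) \<in> vector_fields A"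
  by (simp add: vector_fields_iff tangent_add tapply smooth_fun_add open_chart)

lemma vector_field_scale:
  "smooth_fun A UNIV f \<Longrightarrow> X \<in> vector_fields A \<Longrightarrow> (\<lambda>p. tscale (f p) (X p)) \<in> vector_fields A"
  by (simp add: vector_fields_iff tangent_scale tapply smooth_fun_scaleR open_chart
      smooth_fun_subset[OF _ subset_UNIV])

lemma vector_field_sum:
  "(\<And>i. i \<in> I \<Longrightarrow> X i \<in> vector_fields A) \<Longrightarrow> (\<lambda>p. tsum I (\<lambda>i. X i p)) \<in> vector_fields A"
  by (simp add: vector_fields_iff tangent_sum tapply smooth_fun_sum open_chart)

text \<open>Global vector fields that agree near a point with the coordinate fields of a
  chart. They are indexed by all coordinate vectors \<open>u\<close>; only those for basis vectors form a frame.\<close>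

definition local_frame :: "('a, 'e) chart \<Rightarrow> 'a set \<Rightarrow> ('e \<Rightarrow> ('a, 'e) vfield) \<Rightarrow> bool" where
  "local_frame d N E \<longleftrightarrow> d \<in> A \<and> open N \<and> N \<subseteq> fst d \<and> (\<forall>u. E u \<in> vector_fields A) \<and>
     (\<forall>p\<in>N. \<forall>u. E u p = coord_vec A d p u)"

lemma local_frameD:
  assumes "local_frame d N E"
  shows "d \<in> A" "open N" "N \<subseteq> fst d" "E u \<in> vector_fields A" "p \<in> N \<Longrightarrow> E u p = coord_vec A d p u"
  using assms by (auto simp: local_frame_def)

lemma local_frame_exists:
  assumes "d \<in> A" "q \<in> fst d"
  obtains N E where "local_frame d N E" "q \<in> N"
proof -
  obtain \<Phi> :: "'a \<Rightarrow> real" and K N where \<Phi>: "smooth_fun A UNIV \<Phi>" "closed K" "K \<subseteq> fst d"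
    "\<And>p. p \<notin> K \<Longrightarrow> \<Phi> p = 0" and N: "open N" "q \<in> N" "N \<subseteq> fst d" "\<And>p. p \<in> N \<Longrightarrow> \<Phi> p = 1"
    using bump_function[OF open_chart[OF assms(1)] assms(2)] by blast
  have "local_frame d N (\<lambda>u p. tscale (\<Phi> p) (coord_vec A d p u))"
    unfolding local_frame_def
    using N assms cutoff_field[OF open_chart[OF assms(1)] coord_field[OF assms(1)] \<Phi>] by auto
  then show ?thesis using that N(2) by blast
qed

lemma local_frame_expansion:
  assumes "local_frame d N E" "p \<in> N" "v \<in> tangent_space A p"
  shows "v = tsum Basis (\<lambda>b. tscale (v d \<bullet> b) (E b p))"
  using tangent_expansion[OF assms(3), of d] local_frameD[OF assms(1)] assms(2) by auto

lemma local_frame_coord: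
  assumes "local_frame d N E" "p \<in> N" shows "E u p d = u"
  using local_frameD(1,3,5)[OF assms(1)] assms(2) by (simp add: coord_vec_same subset_iff)

end

section \<open>Affine connections in local frames\<close>

locale connection = smooth_manifold A
  for A :: "('a::{t2_space, second_countable_topology}, 'e::euclidean_space) atlas" +
  fixes nab :: "('a, 'e) connection"
  assumes conn: "affine_connection A nab"
begin

lemma conn_field: "X \<in> vector_fields A \<Longrightarrow> Y \<in> vector_fields A \<Longrightarrow> nab X Y \<in> vector_fields A"
  and conn_add_left: "X \<in> vector_fields A \<Longrightarrow> X' \<in> vector_fields A \<Longrightarrow> Y \<in> vector_fields A \<Longrightarrow>
    nab (\<lambda>p. tadd (X p) (X' p)) Y q = tadd (nab X Y q) (nab X' Y q)"
  and conn_add_right: "X \<in> vector_fields A \<Longrightarrow> Y \<in> vector_fields A \<Longrightarrow> Y' \<in> vector_fields A \<Longrightarrow>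
    nab X (\<lambda>p. tadd (Y p) (Y' p)) q = tadd (nab X Y q) (nab X Y' q)"
  and conn_scale_left: "smooth_fun A UNIV f \<Longrightarrow> X \<in> vector_fields A \<Longrightarrow> Y \<in> vector_fields A \<Longrightarrow>
    nab (\<lambda>p. tscale (f p) (X p)) Y q = tscale (f q) (nab X Y q)"
  and conn_leibniz: "smooth_fun A UNIV f \<Longrightarrow> X \<in> vector_fields A \<Longrightarrow> Y \<in> vector_fields A \<Longrightarrow>
    nab X (\<lambda>p. tscale (f p) (Y p)) q =
    tadd (tscale (tderiv A q (X q) f) (Y q)) (tscale (f q) (nab X Y q))"
  using conn by (simp_all add: affine_connection_def smooth_function_iff)

text \<open>Connections are local operators. A field that vanishes on \<open>N\<close> is unchanged by
  multiplication with a function \<open>f\<close> that has \<open>f q = 0\<close> and equals \<open>1\<close> outside \<open>N\<close>; linearity over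
  functions, respectively the Leibniz rule, then gives \<open>0\<close> at \<open>q\<close>.\<close>

lemma conn_vanish:
  assumes N: "open N" "q \<in> N" and X: "X \<in> vector_fields A" and Y: "Y \<in> vector_fields A"
  shows "(\<And>p. p \<in> N \<Longrightarrow> X p = tzero) \<Longrightarrow> nab X Y q = tzero"
    and "(\<And>p. p \<in> N \<Longrightarrow> Y p = tzero) \<Longrightarrow> nab X Y q = tzero"
proof -
  obtain \<Phi> :: "'a \<Rightarrow> real" and K M where \<Phi>: "smooth_fun A UNIV \<Phi>" "closed K" "K \<subseteq> N"
    "\<And>p. p \<notin> K \<Longrightarrow> \<Phi> p = 0" and M: "open M" "q \<in> M" "M \<subseteq> N" "\<And>p. p \<in> M \<Longrightarrow> \<Phi> p = 1"
    using bump_function[OF N] by blast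
  have s: "smooth_fun A UNIV (\<lambda>p. 1 - \<Phi> p)"
    by (intro smooth_fun_diff smooth_fun_const \<Phi> open_UNIV)
  have *: "(\<lambda>p. tscale (1 - \<Phi> p) (Z p)) = Z" if "\<And>p. p \<in> N \<Longrightarrow> Z p = tzero" for Z :: "('a, 'e) vfield"
  proof
    fix p show "tscale (1 - \<Phi> p) (Z p) = Z p"
    proof (cases "p \<in> N")
      case False
      then have "\<Phi> p = 0" using \<Phi>(3,4) by blast
      then show ?thesis by simp
    qed (simp add: that)
  qed
  have q: "\<Phi> q = 1" using M by simp
  show "nab X Y q = tzero" if 0: "\<And>p. p \<in> N \<Longrightarrow> X p = tzero"
  proof -
    have "(\<lambda>p. tscale (1 - \<Phi> p) (X p)) = X" by (rule *) (rule 0)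
    then show ?thesis using conn_scale_left[OF s X Y, of q] q by simp
  qed
  show "nab X Y q = tzero" if 0: "\<And>p. p \<in> N \<Longrightarrow> Y p = tzero"
  proof -
    have "(\<lambda>p. tscale (1 - \<Phi> p) (Y p)) = Y" by (rule *) (rule 0)
    then show ?thesis using conn_leibniz[OF s X Y, of q] q 0[OF N(2)] by simp
  qed
qed

lemma vector_field_sub:
  "X \<in> vector_fields A \<Longrightarrow> Y \<in> vector_fields A \<Longrightarrow> (\<lambda>p. tsub (X p) (Y p)) \<in> vector_fields A"
  unfolding tsub_eq by (intro vector_field_add vector_field_scale smooth_fun_const)

lemma conn_cong_right:
  assumes N: "open N" "q \<in> N" and X: "X \<in> vector_fields A" and Y: "Y \<in> vector_fields A" "Y' \<in> vector_fields A"
    and eq: "\<And>p. p \<in> N \<Longrightarrow> Y p = Y' p"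
  shows "nab X Y q = nab X Y' q"
proof -
  have "nab X (\<lambda>p. tsub (Y p) (Y' p)) q = tzero"
    by (rule conn_vanish(2)[OF N X vector_field_sub[OF Y]]) (simp add: eq tsub_def tzero_def)
  then show ?thesis
    using conn_add_right[OF X Y(2) vector_field_sub[OF Y], of q] by (simp add: tadd_tsub)
qed

lemma conn_cong_left:
  assumes N: "open N" "q \<in> N" and X: "X \<in> vector_fields A" "X' \<in> vector_fields A" and Y: "Y \<in> vector_fields A"
    and eq: "\<And>p. p \<in> N \<Longrightarrow> X p = X' p"
  shows "nab X Y q = nab X' Y q"
proof -
  have "nab (\<lambda>p. tsub (X p) (X' p)) Y q = tzero"
    by (rule conn_vanish(1)[OF N vector_field_sub[OF X] Y]) (simp add: eq tsub_def tzero_def)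
  then show ?thesis
    using conn_add_left[OF X(2) vector_field_sub[OF X] Y, of q] by (simp add: tadd_tsub)
qed

lemma zero_field: "(\<lambda>p. tzero) \<in> vector_fields A"
  using vector_field_sum[of "{}"] by simp

lemma conn_sum_left:
  assumes "finite I" "\<And>i. i \<in> I \<Longrightarrow> smooth_fun A UNIV (a i)" "\<And>i. i \<in> I \<Longrightarrow> E i \<in> vector_fields A"
    and Y: "Y \<in> vector_fields A"
  shows "nab (\<lambda>p. tsum I (\<lambda>i. tscale (a i p) (E i p))) Y q = tsum I (\<lambda>i. tscale (a i q) (nab (E i) Y q))"
  using assms(1-3)
proof (induction I rule: finite_induct)
  case empty
  show ?case using conn_vanish(1)[OF open_UNIV UNIV_I zero_field Y] by simp
next
  case (insert i I)
  then show ?case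
    by (simp add: tsum_insert conn_add_left vector_field_scale vector_field_sum conn_scale_left Y)
qed

lemma conn_sum_right:
  assumes "finite I" "\<And>i. i \<in> I \<Longrightarrow> smooth_fun A UNIV (a i)" "\<And>i. i \<in> I \<Longrightarrow> E i \<in> vector_fields A"
    and X: "X \<in> vector_fields A"
  shows "nab X (\<lambda>p. tsum I (\<lambda>i. tscale (a i p) (E i p))) q =
    tsum I (\<lambda>i. tadd (tscale (tderiv A q (X q) (a i)) (E i q)) (tscale (a i q) (nab X (E i) q)))"
  using assms(1-3)
proof (induction I rule: finite_induct)
  case empty
  show ?case using conn_vanish(2)[OF open_UNIV UNIV_I X zero_field] by simp
next
  case (insert i I)
  then show ?case
    by (simp add: tsum_insert conn_add_right vector_field_scale vector_field_sum conn_leibniz X)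
qed

lemma conn_frame_left:
  assumes F: "local_frame d N E" "q \<in> N" and X: "X \<in> vector_fields A" and Y: "Y \<in> vector_fields A"
  shows "nab X Y q = tsum Basis (\<lambda>j. tscale (X q d \<bullet> j) (nab (E j) Y q))"
proof -
  note f = local_frameD[OF F(1)]
  obtain \<Phi> :: "'a \<Rightarrow> real" and K M where \<Phi>: "smooth_fun A UNIV \<Phi>" "closed K" "K \<subseteq> N"
    "\<And>p. p \<notin> K \<Longrightarrow> \<Phi> p = 0" and M: "open M" "q \<in> M" "M \<subseteq> N" "\<And>p. p \<in> M \<Longrightarrow> \<Phi> p = 1"
    using bump_function[OF f(2) F(2)] by blast
  \<comment> \<open>Linearity holds over global functions, so the coordinates of \<open>X\<close> are cut off.\<close>
  define x where "x j p = \<Phi> p *\<^sub>R (X p d \<bullet> j)" for j p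
  have x: "smooth_fun A UNIV (x j)" for j
    unfolding x_def
    by (rule cutoff_fun[OF f(2) _ \<Phi> open_UNIV])
      (use smooth_fun_inner_left smooth_fun_subset[OF vector_field_smooth[OF X f(1)] f(3)] f(2) in blast)
  have "nab X Y q = nab (\<lambda>p. tsum Basis (\<lambda>j. tscale (x j p) (E j p))) Y q"
  proof (rule conn_cong_left[OF M(1,2) X _ Y])
    show "(\<lambda>p. tsum Basis (\<lambda>j. tscale (x j p) (E j p))) \<in> vector_fields A"
      by (intro vector_field_sum vector_field_scale x f)
    show "X p = tsum Basis (\<lambda>j. tscale (x j p) (E j p))" if "p \<in> M" for p
      using local_frame_expansion[OF F(1) _ vector_field_tangent[OF X], of p] that M by (auto simp: x_def)
  qed
  also have "\<dots> = tsum Basis (\<lambda>j. tscale (X q d \<bullet> j) (nab (E j) Y q))"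
    using conn_sum_left[OF finite_Basis, of x E Y q] x f(4) Y M by (simp add: x_def)
  finally show ?thesis .
qed

lemma conn_frame_right:
  assumes F: "local_frame d N E" "q \<in> N" and X: "X \<in> vector_fields A" and Y: "Y \<in> vector_fields A"
  shows "nab X Y q d = tderiv A q (X q) (\<lambda>p. Y p d) + (\<Sum>i\<in>Basis. (Y q d \<bullet> i) *\<^sub>R nab X (E i) q d)"
proof -
  note f = local_frameD[OF F(1)]
  obtain \<Phi> :: "'a \<Rightarrow> real" and K M where \<Phi>: "smooth_fun A UNIV \<Phi>" "closed K" "K \<subseteq> N"
    "\<And>p. p \<notin> K \<Longrightarrow> \<Phi> p = 0" and M: "open M" "q \<in> M" "M \<subseteq> N" "\<And>p. p \<in> M \<Longrightarrow> \<Phi> p = 1"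
    using bump_function[OF f(2) F(2)] by blast
  \<comment> \<open>The Leibniz rule requires global coefficients, so the coordinates of \<open>Y\<close> are cut off.\<close>
  define y where "y j p = \<Phi> p *\<^sub>R (Y p d \<bullet> j)" for j p
  have y: "smooth_fun A UNIV (y j)" for j
    unfolding y_def
    by (rule cutoff_fun[OF f(2) _ \<Phi> open_UNIV])
      (use smooth_fun_inner_left smooth_fun_subset[OF vector_field_smooth[OF Y f(1)] f(3)] f(2) in blast)
  have eq: "nab X Y q = nab X (\<lambda>p. tsum Basis (\<lambda>j. tscale (y j p) (E j p))) q"
  proof (rule conn_cong_right[OF M(1,2) X Y])
    show "(\<lambda>p. tsum Basis (\<lambda>j. tscale (y j p) (E j p))) \<in> vector_fields A"
      by (intro vector_field_sum vector_field_scale y f)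
    show "Y p = tsum Basis (\<lambda>j. tscale (y j p) (E j p))" if "p \<in> M" for p
      using local_frame_expansion[OF F(1) _ vector_field_tangent[OF Y], of p] that M by (auto simp: y_def)
  qed
  have "nab X Y q d = (\<Sum>i\<in>Basis. tderiv A q (X q) (y i) *\<^sub>R i + y i q *\<^sub>R nab X (E i) q d)"
    using conn_sum_right[OF finite_Basis, of y E X q] y f(4) X
    by (simp add: eq tapply local_frame_coord[OF F])
  also have "\<dots> = (\<Sum>i\<in>Basis. tderiv A q (X q) (y i) *\<^sub>R i) + (\<Sum>i\<in>Basis. (Y q d \<bullet> i) *\<^sub>R nab X (E i) q d)"
    using M by (simp add: y_def sum.distrib)
  also have "(\<Sum>i\<in>Basis. tderiv A q (X q) (y i) *\<^sub>R i) = tderiv A q (X q) (\<lambda>p. \<Sum>i\<in>Basis. y i p *\<^sub>R i)"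
    by (subst tderiv_sum_scaleR[where U = UNIV])
      (simp_all add: y smooth_fun_const tderiv_const vector_field_tangent[OF X])
  also have "\<dots> = tderiv A q (X q) (\<lambda>p. Y p d)"
  proof (rule tderiv_cong[OF _ M(1,2) vector_field_tangent[OF X]])
    show "smooth_fun A M (\<lambda>p. Y p d)"
      using smooth_fun_subset[OF vector_field_smooth[OF Y f(1)]] f(3) M(3) by blast
    show "Y p d = (\<Sum>i\<in>Basis. y i p *\<^sub>R i)" if "p \<in> M" for p
      using M that by (simp add: y_def euclidean_representation)
  qed
  finally show ?thesis .
qed

text \<open>The classical coordinate formula. By locality, both fields may be replaced by
  combinations of frame fields whose coefficients are cut off to global smooth functions.\<close>

lemma conn_frame:
  assumes F: "local_frame d N E" "q \<in> N" and X: "X \<in> vector_fields A" and Y: "Y \<in> vector_fields A"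
  shows "nab X Y q d = tderiv A q (X q) (\<lambda>p. Y p d) +
    (\<Sum>i\<in>Basis. \<Sum>j\<in>Basis. ((Y q d \<bullet> i) * (X q d \<bullet> j)) *\<^sub>R nab (E j) (E i) q d)"
proof -
  have "nab X (E i) q d = (\<Sum>j\<in>Basis. (X q d \<bullet> j) *\<^sub>R nab (E j) (E i) q d)" for i
    using conn_frame_left[OF F X local_frameD(4)[OF F(1)], of i] by (simp add: tapply)
  then show ?thesis using conn_frame_right[OF F X Y] by (simp add: scaleR_sum_right)
qed

text \<open>The description of the Christoffel symbols in \<open>christoffel_def\<close> determines a unique
  vector: the frame fields provide global fields with locally constant coordinates, and for such fields
  the derivative term of the coordinate formula is zero. The right-hand side is visibly bilinear, and
  smooth in \<open>q\<close> as long as \<open>q\<close> stays in the domain \<open>N\<close> of the frame.\<close>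

lemma christoffel_frame:
  assumes F: "local_frame d N E" "q \<in> N"
  shows "christoffel A nab d q u w =
    (\<Sum>i\<in>Basis. \<Sum>j\<in>Basis. ((w \<bullet> i) * (u \<bullet> j)) *\<^sub>R nab (E j) (E i) q d)" (is "_ = ?\<Gamma> u w")
  unfolding christoffel_def
proof (rule the_equality)
  note f = local_frameD[OF F(1)]
  have "nab X Y q d = ?\<Gamma> u w" if X: "X \<in> vector_fields A" and Y: "Y \<in> vector_fields A"
    and U: "open U" "q \<in> U" "\<forall>r\<in>U \<inter> fst d. X r d = u \<and> Y r d = w" for X Y U
  proof -
    have qU: "q \<in> U \<inter> fst d" "open (U \<inter> fst d)"
      using U F f(3) open_chart[OF f(1)] by auto
    have "tderiv A q (X q) (\<lambda>p. Y p d) = tderiv A q (X q) (\<lambda>p. w)"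
      by (rule tderiv_cong[OF smooth_fun_const qU(2,1) vector_field_tangent[OF X]]) (use U in auto)
    then show ?thesis
      using conn_frame[OF F X Y] U qU by (simp add: tderiv_const vector_field_tangent[OF X])
  qed
  then show "\<forall>X\<in>vector_fields A. \<forall>Y\<in>vector_fields A.
     (\<exists>U. open U \<and> q \<in> U \<and> (\<forall>r\<in>U \<inter> fst d. X r d = u \<and> Y r d = w)) \<longrightarrow> nab X Y q d = ?\<Gamma> u w"
    by blast
  then have *: "nab (E u) (E w) q d = ?\<Gamma> u w"
    using f(2) F local_frame_coord[OF F(1)] f(4) by blast
  fix z assume "\<forall>X\<in>vector_fields A. \<forall>Y\<in>vector_fields A.
     (\<exists>U. open U \<and> q \<in> U \<and> (\<forall>r\<in>U \<inter> fst d. X r d = u \<and> Y r d = w)) \<longrightarrow> nab X Y q d = z"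
  then have "nab (E u) (E w) q d = z"
    using f(2) F local_frame_coord[OF F(1)] f(4) by blast
  then show "z = ?\<Gamma> u w" using * by simp
qed

lemma conn_christoffel:
  assumes "X \<in> vector_fields A" "Y \<in> vector_fields A" "d \<in> A" "q \<in> fst d"
  shows "nab X Y q d = tderiv A q (X q) (\<lambda>p. Y p d) + christoffel A nab d q (X q d) (Y q d)"
proof -
  obtain N E where "local_frame d N E" "q \<in> N" using local_frame_exists[OF assms(3,4)] .
  then show ?thesis using conn_frame christoffel_frame assms by simp
qed

lemma linear_christoffel:
  assumes "d \<in> A" "q \<in> fst d"
  shows "linear (christoffel A nab d q u)"
proof -
  obtain N E where F: "local_frame d N E" "q \<in> N" using local_frame_exists[OF assms] .
  show ?thesis
    unfolding christoffel_frame[OF F]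
    by (rule linearI) (simp_all add: inner_add_left algebra_simps sum.distrib scaleR_sum_right)
qed

end

section \<open>Tensor fields\<close>

context smooth_manifold begin

lemma tensor_tangent: "tensor_field11 A \<Theta> \<Longrightarrow> v \<in> tangent_space A p \<Longrightarrow> \<Theta> p v \<in> tangent_space A p"
  and tensor_linear: "tensor_field11 A \<Theta> \<Longrightarrow> tlinear (tangent_space A p) (\<Theta> p)"
  by (simp_all add: tensor_field11_def tlinear_def)

lemma tensor_sum:
  assumes "tensor_field11 A \<Theta>" "finite I" "\<And>i. i \<in> I \<Longrightarrow> v i \<in> tangent_space A p"
  shows "\<Theta> p (tsum I (\<lambda>i. tscale (a i) (v i))) = tsum I (\<lambda>i. tscale (a i) (\<Theta> p (v i)))"
proof -
  note L = tensor_linear[OF assms(1), of p]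
  have "\<Theta> p (tsum I (\<lambda>i. tscale (a i) (v i))) = tsum I (\<lambda>i. \<Theta> p (tscale (a i) (v i)))"
    by (rule tlinear_sum[OF L assms(2)]) (use assms(3) in \<open>auto intro: tangent_scale\<close>)
  also have "\<dots> = tsum I (\<lambda>i. tscale (a i) (\<Theta> p (v i)))"
    unfolding tsum_def using tlinear_scale[OF L assms(3)] by simp
  finally show ?thesis .
qed

lemma tensor_field:
  assumes \<Theta>: "tensor_field11 A \<Theta>" and Y: "Y \<in> vector_fields A"
  shows "(\<lambda>p. \<Theta> p (Y p)) \<in> vector_fields A"
  unfolding vector_fields_iff
proof (intro conjI allI ballI)
  fix c assume c: "c \<in> A"
  have t: "smooth_fun A (fst c) (\<lambda>p. \<Theta> p (coord_vec A c p u) c)" for u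
    using \<Theta> c by (intro smooth_fun_from_chart[OF c open_chart[OF c] order_refl]) (simp add: tensor_field11_def)
  have "smooth_fun A (fst c) (\<lambda>p. \<Sum>b\<in>Basis. (Y p c \<bullet> b) *\<^sub>R \<Theta> p (coord_vec A c p b) c)"
    by (intro smooth_fun_sum smooth_fun_scaleR smooth_fun_inner_left vector_field_smooth[OF Y c] t open_chart[OF c])
  then show "smooth_fun A (fst c) (\<lambda>p. \<Theta> p (Y p) c)"
  proof (rule smooth_fun_cong[OF _ open_chart[OF c]])
    fix p assume p: "p \<in> fst c"
    have "\<Theta> p (Y p) = tsum Basis (\<lambda>b. tscale (Y p c \<bullet> b) (\<Theta> p (coord_vec A c p b)))"
      using tensor_sum[where a = "\<lambda>b. Y p c \<bullet> b" and v = "coord_vec A c p", OF \<Theta> finite_Basis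
          coord_vec_in[OF c p]]
        tangent_expansion[OF vector_field_tangent[OF Y] c p] by simp
    then show "(\<Sum>b\<in>Basis. (Y p c \<bullet> b) *\<^sub>R \<Theta> p (coord_vec A c p b) c) = \<Theta> p (Y p) c"
      by (simp add: tapply)
  qed
qed (intro tensor_tangent[OF \<Theta>] vector_field_tangent[OF Y])

lemma tangent_extension:
  assumes "v \<in> tangent_space A p"
  obtains Z where "Z \<in> vector_fields A" "Z p = v"
proof -
  obtain d where d: "d \<in> A" "p \<in> fst d" using chart_cover by blast
  obtain N E where F: "local_frame d N E" "p \<in> N" using local_frame_exists[OF d] .
  show ?thesis
  proof (rule that)
    show "(\<lambda>q. tsum Basis (\<lambda>b. tscale (v d \<bullet> b) (E b q))) \<in> vector_fields A"
      by (intro vector_field_sum vector_field_scale smooth_fun_const local_frameD(4)[OF F(1)])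
  qed (use local_frame_expansion[OF F assms] in simp)
qed

end

section \<open>Fields along a smooth map and their covariant derivatives\<close>

locale smooth_mapping = smooth_manifold A + M: smooth_manifold B
  for A :: "('a::{t2_space, second_countable_topology}, 'e::euclidean_space) atlas"
    and B :: "('b::{t2_space, second_countable_topology}, 'f::euclidean_space) atlas" +
  fixes \<iota> :: "'b \<Rightarrow> 'a"
  assumes smooth_iota: "smooth_map B A \<iota>"
begin

abbreviation "dm \<equiv> push B A \<iota>"

lemma open_vimage_iota: "open U \<Longrightarrow> open (\<iota> -` U)"
  using smooth_iota by (auto simp: smooth_map_def intro: open_vimage)

lemma smooth_pullback:
  assumes f: "smooth_fun A U f" and U: "open U"
  shows "smooth_fun B (\<iota> -` U) (\<lambda>p. f (\<iota> p))"
proof (rule M.smooth_fun_local)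
  fix p assume p: "p \<in> \<iota> -` U"
  obtain c where c: "c \<in> B" "p \<in> fst c" using M.chart_cover by blast
  obtain d where d: "d \<in> A" "\<iota> p \<in> fst d" using chart_cover by blast
  define N where "N = fst c \<inter> \<iota> -` (fst d \<inter> U)"
  have oU: "open (fst d \<inter> U)" using U open_chart[OF d(1)] by auto
  have N: "open N" unfolding N_def using open_vimage_iota[OF oU] M.open_chart[OF c(1)] by auto
  have "fst c \<inter> N = N" by (auto simp: N_def)
  then have S: "open (snd c ` N)" using M.open_chart_image[OF c(1) N] by simp
  have "smooth_fun B N (\<lambda>p. f (\<iota> p))"
  proof (rule M.smooth_fun_from_chart[OF c(1) N])
    have "smooth_on (snd c ` N) (\<lambda>x. f (chart_inv d (snd d (\<iota> (chart_inv c x)))))"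
    proof (rule smooth_on_compose[OF _ _ S open_chart_image[OF d(1) U]])
      show "smooth_on (snd d ` (fst d \<inter> U)) (\<lambda>x. f (chart_inv d x))"
        using f d by (simp add: smooth_fun_def)
      have "smooth_on (snd c ` (fst c \<inter> \<iota> -` fst d)) (\<lambda>x. snd d (\<iota> (chart_inv c x)))"
        using smooth_iota c d by (simp add: smooth_map_def comp_def)
      then show "smooth_on (snd c ` N) (\<lambda>x. snd d (\<iota> (chart_inv c x)))"
        by (rule smooth_on_subset) (auto simp: N_def)
    qed (auto simp: N_def M.chart_inv_left[OF c(1)])
    then show "smooth_on (snd c ` N) (\<lambda>x. f (\<iota> (chart_inv c x)))"
      by (rule smooth_on_cong[OF _ S]) (auto simp: N_def M.chart_inv_left[OF c(1)] chart_inv_left[OF d(1)])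
  qed (auto simp: N_def)
  then show "\<exists>N. open N \<and> p \<in> N \<and> smooth_fun B N (\<lambda>p. f (\<iota> p))"
    using N p c d by (auto simp: N_def)
qed

lemma smooth_iota_coord: "d \<in> A \<Longrightarrow> smooth_fun B (\<iota> -` fst d) (\<lambda>p. snd d (\<iota> p))"
  by (intro smooth_pullback smooth_fun_chart open_chart)

lemma push_coord: "d \<in> A \<Longrightarrow> \<iota> p \<in> fst d \<Longrightarrow> dm p v d = tderiv B p v (\<lambda>q. snd d (\<iota> q))"
  by (simp add: push_def comp_def)

text \<open>Chain rule for \<open>f \<circ> \<iota>\<close>. Applied to the coordinate functions of a second chart it
  shows that pushed forward vectors transform correctly.\<close>

lemma tderiv_pullback_coord:
  assumes v: "v \<in> tangent_space B p" and d: "d \<in> A" "\<iota> p \<in> fst d"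
    and f: "((\<lambda>x. f (chart_inv d x)) has_derivative F) (at (snd d (\<iota> p)))"
  shows "tderiv B p v (\<lambda>q. f (\<iota> q)) = F (dm p v d)"
proof -
  obtain c where c: "c \<in> B" "p \<in> fst c" using M.chart_cover by blast
  define J where "J = frechet_derivative (\<lambda>x. snd d (\<iota> (chart_inv c x))) (at (snd c p))"
  have J: "((\<lambda>x. snd d (\<iota> (chart_inv c x))) has_derivative J) (at (snd c p))"
    unfolding J_def using M.smooth_fun_has_derivative[OF smooth_iota_coord[OF d(1)] c] d by simp
  have "((\<lambda>x. f (chart_inv d (snd d (\<iota> (chart_inv c x))))) has_derivative (\<lambda>u. F (J u))) (at (snd c p))"
    by (rule has_derivative_compose[OF J]) (use f M.chart_inv_left[OF c] in simp)
  then have "((\<lambda>x. f (\<iota> (chart_inv c x))) has_derivative (\<lambda>u. F (J u))) (at (snd c p))"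
    by (rule has_derivative_transform_within_open[OF _
          M.open_chart_image[OF c(1) open_vimage_iota[OF open_chart[OF d(1)]]]])
      (use c d in \<open>auto simp: M.chart_inv_left[OF c(1)] chart_inv_left[OF d(1)]\<close>)
  from M.tderiv_eq[OF v c this] have "tderiv B p v (\<lambda>q. f (\<iota> q)) = F (J (v c))" .
  also have "J (v c) = dm p v d" using M.tderiv_eq[OF v c J] push_coord[OF d] by simp
  finally show ?thesis .
qed

lemma push_tangent:
  assumes v: "v \<in> tangent_space B p"
  shows "dm p v \<in> tangent_space A (\<iota> p)"
proof (rule tangentI)
  fix c d assume *: "c \<in> A" "d \<in> A" "\<iota> p \<in> fst c" "\<iota> p \<in> fst d"
  show "dm p v d = jac c d (\<iota> p) (dm p v c)"
    using tderiv_pullback_coord[OF v *(1,3) jac_has_derivative[OF *]] push_coord[OF *(2,4)] by simp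
qed (auto simp: push_def)

lemma tderiv_pullback:
  assumes v: "v \<in> tangent_space B p" and f: "smooth_fun A U f" "\<iota> p \<in> U"
  shows "tderiv B p v (\<lambda>q. f (\<iota> q)) = tderiv A (\<iota> p) (dm p v) f"
proof -
  obtain d where d: "d \<in> A" "\<iota> p \<in> fst d" using chart_cover by blast
  show ?thesis
    using tderiv_pullback_coord[OF v d smooth_fun_has_derivative[OF f(1) d f(2)]]
      tderiv_smooth[OF f(1) push_tangent[OF v] d f(2)] by simp
qed

lemma push_linear: "tlinear (tangent_space B p) (dm p)"
proof -
  have "dm p (tadd v w) d = tadd (dm p v) (dm p w) d \<and> dm p (tscale a v) d = tscale a (dm p v) d"
    if "v \<in> tangent_space B p" "w \<in> tangent_space B p" for v w a d
  proof (cases "d \<in> A \<and> \<iota> p \<in> fst d")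
    case True
    then show ?thesis
      using M.tderiv_linear[OF smooth_iota_coord _ that, of d] by (simp add: push_coord tapply)
  qed (auto simp: push_def tapply)
  then show ?thesis unfolding tlinear_def by blast
qed

text \<open>A smooth section of the pull-back of the ambient tangent bundle.\<close>

definition field_along :: "('b \<Rightarrow> ('a, 'e) tvec) \<Rightarrow> bool" where
  "field_along W \<longleftrightarrow> (\<forall>p. W p \<in> tangent_space A (\<iota> p)) \<and>
     (\<forall>d\<in>A. smooth_fun B (\<iota> -` fst d) (\<lambda>p. W p d))"

lemma field_along_tangent: "field_along W \<Longrightarrow> W p \<in> tangent_space A (\<iota> p)"
  and field_along_smooth: "field_along W \<Longrightarrow> d \<in> A \<Longrightarrow> smooth_fun B (\<iota> -` fst d) (\<lambda>p. W p d)"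
  by (simp_all add: field_along_def)

lemma push_field:
  assumes "X \<in> vector_fields B"
  shows "field_along (\<lambda>p. dm p (X p))"
  unfolding field_along_def
proof (intro conjI allI ballI push_tangent M.vector_field_tangent assms)
  fix d assume d: "d \<in> A"
  show "smooth_fun B (\<iota> -` fst d) (\<lambda>p. dm p (X p) d)"
    by (rule M.smooth_fun_cong[OF M.smooth_tderiv[OF assms _ smooth_iota_coord[OF d]]])
      (use d open_vimage_iota[OF open_chart[OF d]] in \<open>auto simp: push_coord\<close>)
qed

lemma field_along_expansion:
  assumes W: "field_along W" and F: "local_frame d N E"
  shows "\<And>p. p \<in> \<iota> -` N \<Longrightarrow> W p = tsum Basis (\<lambda>b. tscale (W p d \<bullet> b) (E b (\<iota> p)))"
    and "\<And>b. smooth_fun B (\<iota> -` N) (\<lambda>p. W p d \<bullet> b)"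
proof -
  note f = local_frameD[OF F]
  show "W p = tsum Basis (\<lambda>b. tscale (W p d \<bullet> b) (E b (\<iota> p)))" if "p \<in> \<iota> -` N" for p
    using local_frame_expansion[OF F _ field_along_tangent[OF W]] that by auto
  show "smooth_fun B (\<iota> -` N) (\<lambda>p. W p d \<bullet> b)" for b
    by (rule M.smooth_fun_inner_left[OF M.smooth_fun_subset[OF field_along_smooth[OF W f(1)]]])
      (use f(2,3) open_vimage_iota in auto)
qed

text \<open>The pull-back connection in terms of the ambient one. Writing a field along \<open>\<iota>\<close> locally
  as \<open>\<Sum> a\<^sub>i (E\<^sub>i \<circ> \<iota>)\<close> with ambient fields \<open>E\<^sub>i\<close>, the Leibniz rule gives
  \<open>\<nabla>\<^sub>X W = \<Sum> X(a\<^sub>i) E\<^sub>i + a\<^sub>i \<nabla>\<^sub>Z E\<^sub>i\<close> for any ambient \<open>Z\<close> with the value \<open>d\<iota> X\<close> at the point. In each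
  chart, the derivative term and the Christoffel term of \<open>along_deriv_def\<close> add up to the coordinate
  formula for \<open>\<nabla>\<^sub>Z E\<^sub>i\<close>. The \<open>E\<^sub>i\<close> are arbitrary, so as to cover both a frame and its image under
  \<open>\<Theta>\<close>.\<close>

lemma along_deriv_sum:
  assumes nab: "affine_connection A nab"
    and x: "X p \<in> tangent_space B p" and Z: "Z \<in> vector_fields A" "Z (\<iota> p) = dm p (X p)"
    and N: "open N" "p \<in> N" and I: "finite I"
    and a: "\<And>i. i \<in> I \<Longrightarrow> smooth_fun B N (a i)" and E: "\<And>i. i \<in> I \<Longrightarrow> E i \<in> vector_fields A"
    and W: "\<And>q. q \<in> N \<Longrightarrow> W q = tsum I (\<lambda>i. tscale (a i q) (E i (\<iota> q)))"
  shows "along_deriv B A \<iota> nab X W p = tsum I (\<lambda>i. tadd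
      (tscale (tderiv B p (X p) (a i)) (E i (\<iota> p))) (tscale (a i p) (nab Z (E i) (\<iota> p))))" (is "_ = ?R")
proof
  interpret connection A nab by unfold_locales (rule nab)
  fix d
  have R: "?R \<in> tangent_space A (\<iota> p)"
    by (intro tangent_sum tangent_add tangent_scale vector_field_tangent E conn_field Z)
  show "along_deriv B A \<iota> nab X W p d = ?R d"
  proof (cases "d \<in> A \<and> \<iota> p \<in> fst d")
    case False
    then show ?thesis using tangent_outside[OF R False] by (auto simp: along_deriv_def)
  next
    case True
    then have d: "d \<in> A" "\<iota> p \<in> fst d" by auto
    define N' where "N' = N \<inter> \<iota> -` fst d"
    have N': "open N'" "p \<in> N'" "N' \<subseteq> N"
      using N d open_vimage_iota[OF open_chart[OF d(1)]] by (auto simp: N'_def)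
    have a': "smooth_fun B N' (a i)" if "i \<in> I" for i
      using M.smooth_fun_subset[OF a[OF that] N'(3)] .
    have E': "smooth_fun B N' (\<lambda>q. E i (\<iota> q) d)" if "i \<in> I" for i
      by (rule M.smooth_fun_subset[OF smooth_pullback[OF vector_field_smooth[OF E[OF that] d(1)] open_chart[OF d(1)]]])
        (auto simp: N'_def)
    have "tderiv B p (X p) (\<lambda>q. W q d) = tderiv B p (X p) (\<lambda>q. \<Sum>i\<in>I. a i q *\<^sub>R E i (\<iota> q) d)"
    proof (rule M.tderiv_cong[OF _ N'(1,2) x])
      show "smooth_fun B N' (\<lambda>q. \<Sum>i\<in>I. a i q *\<^sub>R E i (\<iota> q) d)"
        by (intro M.smooth_fun_sum M.smooth_fun_scaleR a' E' N')
      show "(\<Sum>i\<in>I. a i q *\<^sub>R E i (\<iota> q) d) = W q d" if "q \<in> N'" for q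
        using W[of q] N'(3) that by (auto simp: tapply)
    qed
    also have "\<dots> = (\<Sum>i\<in>I. tderiv B p (X p) (a i) *\<^sub>R E i (\<iota> p) d +
        a i p *\<^sub>R tderiv B p (X p) (\<lambda>q. E i (\<iota> q) d))"
      by (rule M.tderiv_sum_scaleR[OF a' E' N'(2) x])
    also have "\<dots> = (\<Sum>i\<in>I. tderiv B p (X p) (a i) *\<^sub>R E i (\<iota> p) d +
        a i p *\<^sub>R tderiv A (\<iota> p) (Z (\<iota> p)) (\<lambda>q. E i q d))"
      using tderiv_pullback[OF x vector_field_smooth[OF E d(1)] d(2)] Z(2) by simp
    finally have 1: "tderiv B p (X p) (\<lambda>q. W q d) = \<dots>" .
    have "christoffel A nab d (\<iota> p) (dm p (X p) d) (W p d) =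
        (\<Sum>i\<in>I. a i p *\<^sub>R christoffel A nab d (\<iota> p) (Z (\<iota> p) d) (E i (\<iota> p) d))"
      using W[OF N(2)] Z(2) linear_christoffel[OF d]
      by (simp add: tapply linear_sum linear_cmul)
    then have "along_deriv B A \<iota> nab X W p d = (\<Sum>i\<in>I. tderiv B p (X p) (a i) *\<^sub>R E i (\<iota> p) d +
        a i p *\<^sub>R (tderiv A (\<iota> p) (Z (\<iota> p)) (\<lambda>q. E i q d) + christoffel A nab d (\<iota> p) (Z (\<iota> p) d) (E i (\<iota> p) d)))"
      using 1 True by (simp add: along_deriv_def sum.distrib algebra_simps)
    then show ?thesis
      using conn_christoffel[OF Z(1) E d] by (simp add: tapply)
  qed
qed

lemma along_deriv_frame:
  assumes nab: "affine_connection A nab"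
    and x: "X p \<in> tangent_space B p" and Z: "Z \<in> vector_fields A" "Z (\<iota> p) = dm p (X p)"
    and F: "local_frame d N E" "\<iota> p \<in> N" and W: "field_along W"
  shows "along_deriv B A \<iota> nab X W p = tsum Basis (\<lambda>b. tadd
      (tscale (tderiv B p (X p) (\<lambda>q. W q d \<bullet> b)) (E b (\<iota> p))) (tscale (W p d \<bullet> b) (nab Z (E b) (\<iota> p))))"
proof (rule along_deriv_sum[where X = X and Z = Z and N = "\<iota> -` N" and E = E, OF nab x Z _ _ finite_Basis])
  show "open (\<iota> -` N)" by (rule open_vimage_iota[OF local_frameD(2)[OF F(1)]])
  show "p \<in> \<iota> -` N" using F by simp
  show "smooth_fun B (\<iota> -` N) (\<lambda>q. W q d \<bullet> b)" for b by (rule field_along_expansion(2)[OF W F(1)])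
  show "E b \<in> vector_fields A" for b by (rule local_frameD(4)[OF F(1)])
  show "W q = tsum Basis (\<lambda>b. tscale (W q d \<bullet> b) (E b (\<iota> q)))" if "q \<in> \<iota> -` N" for q
    by (rule field_along_expansion(1)[OF W F(1) that])
qed

text \<open>The expansion in a frame writes the derivative, which is defined chart by chart, as a
  combination of values of ambient vector fields.\<close>

lemma along_deriv_tangent:
  assumes nab: "affine_connection A nab" and x: "X p \<in> tangent_space B p" and W: "field_along W"
  shows "along_deriv B A \<iota> nab X W p \<in> tangent_space A (\<iota> p)"
proof -
  interpret connection A nab by unfold_locales (rule nab)
  obtain Z where Z: "Z \<in> vector_fields A" "Z (\<iota> p) = dm p (X p)"
    using tangent_extension[OF push_tangent[OF x]] .
  obtain d where d: "d \<in> A" "\<iota> p \<in> fst d" using chart_cover by blast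
  obtain N E where F: "local_frame d N E" "\<iota> p \<in> N" using local_frame_exists[OF d] .
  show ?thesis
    unfolding along_deriv_frame[where X = X, OF nab x Z F W]
    by (intro tangent_sum tangent_add tangent_scale vector_field_tangent local_frameD(4)[OF F(1)] conn_field Z)
qed

text \<open>Near a point, the Christoffel symbols are combinations of the smooth components of
  \<open>\<nabla>\<^bsub>E\<^sub>j\<^esub> E\<^sub>i\<close> for one fixed frame.\<close>

lemma along_deriv_field:
  assumes nab: "affine_connection A nab" and X: "X \<in> vector_fields B" and W: "field_along W"
  shows "field_along (along_deriv B A \<iota> nab X W)"
  unfolding field_along_def
proof (intro conjI allI ballI along_deriv_tangent[OF nab M.vector_field_tangent[OF X] W])
  interpret connection A nab by unfold_locales (rule nab)
  fix d assume d: "d \<in> A"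
  show "smooth_fun B (\<iota> -` fst d) (\<lambda>p. along_deriv B A \<iota> nab X W p d)"
  proof (rule M.smooth_fun_local)
    fix p assume "p \<in> \<iota> -` fst d"
    then obtain N E where F: "local_frame d N E" "\<iota> p \<in> N" using local_frame_exists[OF d, of "\<iota> p"] by auto
    note f = local_frameD[OF F(1)]
    have N: "open (\<iota> -` N)" "\<iota> -` N \<subseteq> \<iota> -` fst d" using open_vimage_iota[OF f(2)] f(3) by auto
    have "smooth_fun B (\<iota> -` N) (\<lambda>q. nab (E j) (E i) (\<iota> q) d)" for i j
      by (rule M.smooth_fun_subset[OF smooth_pullback[OF vector_field_smooth[OF conn_field d] open_chart[OF d]] N(2)])
        (rule f)+
    then have "smooth_fun B (\<iota> -` N) (\<lambda>q. tderiv B q (X q) (\<lambda>q. W q d) +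
        (\<Sum>i\<in>Basis. \<Sum>j\<in>Basis. ((W q d \<bullet> i) * (dm q (X q) d \<bullet> j)) *\<^sub>R nab (E j) (E i) (\<iota> q) d))"
      by (intro M.smooth_fun_add M.smooth_fun_sum M.smooth_fun_scaleR M.smooth_fun_mult N
          M.smooth_tderiv[OF X] field_along_expansion(2)[OF W F(1)]
          field_along_expansion(2)[OF push_field[OF X] F(1)]
          M.smooth_fun_subset[OF field_along_smooth[OF W d] N(2)])
    then have "smooth_fun B (\<iota> -` N) (\<lambda>q. along_deriv B A \<iota> nab X W q d)"
      by (rule M.smooth_fun_cong[OF _ N(1)])
        (use d f(3) in \<open>auto simp: along_deriv_def christoffel_frame[OF F(1)]\<close>)
    then show "\<exists>N. open N \<and> p \<in> N \<and> smooth_fun B N (\<lambda>p. along_deriv B A \<iota> nab X W p d)"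
      using N(1) F(2) by blast
  qed
qed

text \<open>The gauge equation carries over from ambient fields to fields along \<open>\<iota>\<close>. If
  \<open>W = \<Sum> a\<^sub>i (E\<^sub>i \<circ> \<iota>)\<close> then \<open>\<Theta> W = \<Sum> a\<^sub>i (\<Theta> E\<^sub>i \<circ> \<iota>)\<close> with the same coefficients, and the two expansions
  correspond term by term under \<open>\<Theta>\<close>.\<close>

lemma tensor_along:
  assumes nab: "affine_connection A nab" "affine_connection A nabs"
    and \<Theta>: "tensor_field11 A \<Theta>"
    and gauge: "\<forall>X\<in>vector_fields A. \<forall>Y\<in>vector_fields A. \<forall>p.
        nab X (\<lambda>q. \<Theta> q (Y q)) p = \<Theta> p (nabs X Y p)"
    and x: "X p \<in> tangent_space B p" and W: "field_along W"
  shows "along_deriv B A \<iota> nab X (\<lambda>q. \<Theta> (\<iota> q) (W q)) p = \<Theta> (\<iota> p) (along_deriv B A \<iota> nabs X W p)"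
proof -
  interpret nabs: connection A nabs by unfold_locales (rule nab)
  obtain Z where Z: "Z \<in> vector_fields A" "Z (\<iota> p) = dm p (X p)"
    using tangent_extension[OF push_tangent[OF x]] .
  obtain d where d: "d \<in> A" "\<iota> p \<in> fst d" using chart_cover by blast
  obtain N E where F: "local_frame d N E" "\<iota> p \<in> N" using local_frame_exists[OF d] .
  note f = local_frameD[OF F(1)]
  let ?a = "\<lambda>b q. W q d \<bullet> b"
  note L = tensor_linear[OF \<Theta>, of "\<iota> p"]
  have "along_deriv B A \<iota> nab X (\<lambda>q. \<Theta> (\<iota> q) (W q)) p = tsum Basis (\<lambda>b. tadd
      (tscale (tderiv B p (X p) (?a b)) (\<Theta> (\<iota> p) (E b (\<iota> p))))
      (tscale (?a b p) (nab Z (\<lambda>q. \<Theta> q (E b q)) (\<iota> p))))"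
  proof (rule along_deriv_sum[where X = X and Z = Z and N = "\<iota> -` N" and a = ?a
        and E = "\<lambda>b q. \<Theta> q (E b q)", OF nab(1) x Z _ _ finite_Basis])
    show "open (\<iota> -` N)" by (rule open_vimage_iota[OF f(2)])
    show "p \<in> \<iota> -` N" using F by simp
    show "smooth_fun B (\<iota> -` N) (?a b)" for b by (rule field_along_expansion(2)[OF W F(1)])
    show "(\<lambda>q. \<Theta> q (E b q)) \<in> vector_fields A" for b by (rule tensor_field[OF \<Theta> f(4)])
    fix q assume q: "q \<in> \<iota> -` N"
    show "\<Theta> (\<iota> q) (W q) = tsum Basis (\<lambda>b. tscale (?a b q) (\<Theta> (\<iota> q) (E b (\<iota> q))))"
      using tensor_sum[where a = "\<lambda>b. ?a b q" and v = "\<lambda>b. E b (\<iota> q)", OF \<Theta> finite_Basis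
          vector_field_tangent[OF f(4)]]
       field_along_expansion(1)[OF W F(1) q] by simp
  qed
  also have "\<dots> = tsum Basis (\<lambda>b. \<Theta> (\<iota> p) (tadd
      (tscale (tderiv B p (X p) (?a b)) (E b (\<iota> p))) (tscale (?a b p) (nabs Z (E b) (\<iota> p)))))"
    using vector_field_tangent[OF f(4)] vector_field_tangent[OF nabs.conn_field[OF Z(1) f(4)]]
    by (simp add: gauge[rule_format, OF Z(1) f(4)] tlinear_add[OF L] tlinear_scale[OF L] tangent_scale)
  also have "\<dots> = \<Theta> (\<iota> p) (tsum Basis (\<lambda>b. tadd
      (tscale (tderiv B p (X p) (?a b)) (E b (\<iota> p))) (tscale (?a b p) (nabs Z (E b) (\<iota> p)))))"
    by (rule tlinear_sum[OF L finite_Basis, symmetric])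
      (intro tangent_add tangent_scale vector_field_tangent f nabs.conn_field Z)
  also have "\<dots> = \<Theta> (\<iota> p) (along_deriv B A \<iota> nabs X W p)"
    using along_deriv_frame[where X = X, OF nab(2) x Z F W] by simp
  finally show ?thesis .
qed

end

section \<open>Smooth solutions of positive definite linear systems\<close>

context smooth_manifold begin

lemma smooth_fun_bilinear_apply:
  fixes G :: "'a \<Rightarrow> 'f::euclidean_space \<Rightarrow> 'f \<Rightarrow> real"
  assumes U: "open U" and G: "\<And>q. q \<in> U \<Longrightarrow> bilinear (G q)" "\<And>u v. smooth_fun A U (\<lambda>q. G q u v)"
    and x: "smooth_fun A U x" and y: "smooth_fun A U y"
  shows "smooth_fun A U (\<lambda>q. G q (x q) (y q))"
proof (rule smooth_fun_cong[OF _ U])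
  show "smooth_fun A U (\<lambda>q. \<Sum>a\<in>Basis. \<Sum>b\<in>Basis. ((x q \<bullet> a) * (y q \<bullet> b)) *\<^sub>R G q a b)"
    by (intro smooth_fun_sum smooth_fun_scaleR smooth_fun_mult smooth_fun_inner_left x y U G)
  fix q assume "q \<in> U"
  then have l: "linear (\<lambda>u. G q u v)" "linear (G q u)" for u v
    using G(1) by (auto simp: bilinear_def)
  show "(\<Sum>a\<in>Basis. \<Sum>b\<in>Basis. ((x q \<bullet> a) * (y q \<bullet> b)) *\<^sub>R G q a b) = G q (x q) (y q)"
    unfolding linear_basis_expansion[OF l(1), of "x q"] linear_basis_expansion[OF l(2), of _ "y q"]
    by (simp add: sum_distrib_left, subst sum.swap, simp add: mult_ac)
qed

text \<open>Gram--Schmidt without normalisation uses only field operations, so it depends smoothly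
  on the inner product. It is started from the standard basis, one basis vector at a time; the span
  condition keeps the new vector from vanishing.\<close>

lemma smooth_gram_schmidt:
  fixes G :: "'a \<Rightarrow> 'f::euclidean_space \<Rightarrow> 'f \<Rightarrow> real"
  assumes U: "open U" and G: "\<And>q. q \<in> U \<Longrightarrow> bilinear (G q)" "\<And>u v. smooth_fun A U (\<lambda>q. G q u v)"
    and sym: "\<And>q u v. q \<in> U \<Longrightarrow> G q u v = G q v u"
    and pos: "\<And>q u. q \<in> U \<Longrightarrow> u \<noteq> 0 \<Longrightarrow> G q u u > 0"
    and I: "finite I" "I \<subseteq> Basis"
  shows "\<exists>F. (\<forall>i\<in>I. smooth_fun A U (F i)) \<and> (\<forall>q\<in>U. (\<forall>i\<in>I. F i q \<noteq> 0) \<and>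
    (\<forall>i\<in>I. \<forall>j\<in>I. i \<noteq> j \<longrightarrow> G q (F i q) (F j q) = 0) \<and> span ((\<lambda>i. F i q) ` I) = span I)"
  using I
proof (induction I rule: finite_induct)
  case empty
  show ?case by simp
next
  case (insert b I)
  then obtain F where F_ex: "\<forall>i\<in>I. smooth_fun A U (F i)"
    "\<forall>q\<in>U. (\<forall>i\<in>I. F i q \<noteq> 0) \<and>
      (\<forall>i\<in>I. \<forall>j\<in>I. i \<noteq> j \<longrightarrow> G q (F i q) (F j q) = 0) \<and> span ((\<lambda>i. F i q) ` I) = span I"
    by auto
  have F: "smooth_fun A U (F i)" if "i \<in> I" for i using F_ex(1) that by blast
  have nz: "F i q \<noteq> 0" if "q \<in> U" "i \<in> I" for q i using F_ex(2) that by blast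
  have orth: "G q (F i q) (F j q) = 0" if "q \<in> U" "i \<in> I" "j \<in> I" "i \<noteq> j" for q i j
    using F_ex(2) that by blast
  have span: "span ((\<lambda>i. F i q) ` I) = span I" if "q \<in> U" for q using F_ex(2) that by blast
  define k where "k i q = G q b (F i q) / G q (F i q) (F i q)" for i q
  define s where "s q = (\<Sum>i\<in>I. k i q *\<^sub>R F i q)" for q
  define F' where "F' i = (if i = b then (\<lambda>q. b - s q) else F i)" for i
  have F'_I: "F' i = F i" if "i \<in> I" for i using that insert.hyps by (auto simp: F'_def)
  have F'_b: "F' b q = b - s q" for q by (simp add: F'_def)
  have nzG: "G q (F i q) (F i q) \<noteq> 0" if "q \<in> U" "i \<in> I" for q i
    using pos[OF that(1) nz[OF that]] by simp
  have k: "smooth_fun A U (k i)" if "i \<in> I" for i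
    unfolding k_def
    by (intro smooth_fun_divide smooth_fun_bilinear_apply[OF U G] smooth_fun_const F that U nzG)
  have "smooth_fun A U (\<lambda>q. b - s q)"
    unfolding s_def by (intro smooth_fun_diff smooth_fun_const smooth_fun_sum smooth_fun_scaleR k F U)
  then have smooth: "\<forall>i\<in>insert b I. smooth_fun A U (F' i)" using F F'_I by (auto simp: F'_def)
  have pointwise: "(\<forall>i\<in>insert b I. F' i q \<noteq> 0) \<and>
    (\<forall>i\<in>insert b I. \<forall>j\<in>insert b I. i \<noteq> j \<longrightarrow> G q (F' i q) (F' j q) = 0) \<and>
    span ((\<lambda>i. F' i q) ` insert b I) = span (insert b I)" if q: "q \<in> U" for q
  proof -
    have l: "linear (\<lambda>u. G q u v)" for v using G(1)[OF q] by (auto simp: bilinear_def)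
    \<comment> \<open>The correction term stays in the old span, which does not contain \<open>b\<close>.\<close>
    have s: "s q \<in> span I"
      unfolding s_def span[OF q, symmetric] by (intro span_sum span_scale span_base) auto
    have "b \<notin> span I"
      using insert.hyps insert.prems independent_Basis span_mono[of I "Basis - {b}"]
      unfolding dependent_def by blast
    then have "F' b q \<noteq> 0" using s by (auto simp: F'_b)
    moreover have Gb: "G q (F' b q) (F' j q) = 0" if j: "j \<in> I" for j
    proof -
      have "G q (s q) (F j q) = (\<Sum>i\<in>I. k i q * G q (F i q) (F j q))"
        unfolding s_def by (simp add: linear_sum[OF l] linear_cmul[OF l])
      also have "\<dots> = (\<Sum>i\<in>I. if i = j then G q b (F j q) else 0)"
        using orth[OF q _ j] nzG[OF q j] by (intro sum.cong refl) (auto simp: k_def)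
      also have "\<dots> = G q b (F j q)" using insert.hyps j by simp
      finally show ?thesis by (simp add: F'_b F'_I j linear_diff[OF l])
    qed
    moreover have "span ((\<lambda>i. F' i q) ` insert b I) = span (insert b I)"
    proof -
      have "(\<lambda>i. F' i q) ` insert b I = insert (b - s q) ((\<lambda>i. F i q) ` I)"
        using F'_I F'_b by auto
      moreover have "span (insert (b - s q) ((\<lambda>i. F i q) ` I)) = span (insert (b - s q) I)"
        unfolding span_insert span[OF q] by simp
      moreover have "span (insert (b - s q) I) = span (insert b I)"
      proof (rule span_eq[THEN iffD2], intro conjI insert_subsetI)
        have si: "s q \<in> span (insert x I)" for x
          using s span_mono[of I "insert x I"] by auto
        show "b - s q \<in> span (insert b I)" by (intro span_diff si span_base) auto
        have "b - s q + s q \<in> span (insert (b - s q) I)" by (intro span_add si span_base) auto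
        then show "b \<in> span (insert (b - s q) I)" by simp
      qed (auto intro: span_base)
      ultimately show ?thesis by simp
    qed
    ultimately show ?thesis
      using F'_I nz[OF q] orth[OF q] sym[OF q] by auto
  qed
  show ?case
    by (rule exI[of _ F']) (use smooth pointwise in blast)
qed

text \<open>The solution of a positive definite linear system depends smoothly on its data: in an
  orthogonal basis \<open>F\<^sub>i\<close> it is \<open>\<Sum> \<beta>(F\<^sub>i) / G(F\<^sub>i, F\<^sub>i) F\<^sub>i\<close>.\<close>

lemma smooth_riesz:
  fixes G :: "'a \<Rightarrow> 'f::euclidean_space \<Rightarrow> 'f \<Rightarrow> real"
  assumes U: "open U" and G: "\<And>q. q \<in> U \<Longrightarrow> bilinear (G q)" "\<And>u v. smooth_fun A U (\<lambda>q. G q u v)"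
    and sym: "\<And>q u v. q \<in> U \<Longrightarrow> G q u v = G q v u"
    and pos: "\<And>q u. q \<in> U \<Longrightarrow> u \<noteq> 0 \<Longrightarrow> G q u u > 0"
    and \<beta>: "\<And>q. q \<in> U \<Longrightarrow> linear (\<beta> q)" "\<And>u. smooth_fun A U (\<lambda>q. \<beta> q u :: real)"
  obtains v where "smooth_fun A U v" "\<And>q u. q \<in> U \<Longrightarrow> G q (v q) u = \<beta> q u"
proof -
  have "\<exists>F. (\<forall>i\<in>(Basis :: 'f set). smooth_fun A U (F i)) \<and> (\<forall>q\<in>U. (\<forall>i\<in>Basis. F i q \<noteq> 0) \<and>
      (\<forall>i\<in>Basis. \<forall>j\<in>Basis. i \<noteq> j \<longrightarrow> G q (F i q) (F j q) = 0) \<and>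
      span ((\<lambda>i. F i q) ` Basis) = span Basis)"
  proof (rule smooth_gram_schmidt[where G = G and I = Basis])
    show "G q u v = G q v u" if "q \<in> U" for q u v using that by (rule sym)
  qed (use U G pos in auto)
  then obtain F where F: "\<forall>i\<in>(Basis :: 'f set). smooth_fun A U (F i)"
    and FU: "\<forall>q\<in>U. (\<forall>i\<in>Basis. F i q \<noteq> 0) \<and>
      (\<forall>i\<in>Basis. \<forall>j\<in>Basis. i \<noteq> j \<longrightarrow> G q (F i q) (F j q) = 0) \<and> span ((\<lambda>i. F i q) ` Basis) = span Basis"
    by blast
  have F: "smooth_fun A U (F i)" if "i \<in> Basis" for i using F that by blast
  have nz: "F i q \<noteq> 0" if "q \<in> U" "i \<in> Basis" for q i using FU that by blast
  have orth: "G q (F i q) (F j q) = 0" if "q \<in> U" "i \<in> Basis" "j \<in> Basis" "i \<noteq> j" for q i j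
    using FU that by blast
  have span: "span ((\<lambda>i. F i q) ` Basis) = span Basis" if "q \<in> U" for q using FU that by blast
  have nzG: "G q (F i q) (F i q) \<noteq> 0" if "q \<in> U" "i \<in> Basis" for q i
    using pos[OF that(1) nz[OF that]] by simp
  define v where "v q = (\<Sum>i\<in>Basis. (\<beta> q (F i q) / G q (F i q) (F i q)) *\<^sub>R F i q)" for q
  have "smooth_fun A U (\<lambda>q. \<beta> q (F i q))" if "i \<in> Basis" for i
  proof (rule smooth_fun_cong[OF _ U])
    show "smooth_fun A U (\<lambda>q. \<Sum>b\<in>Basis. (F i q \<bullet> b) *\<^sub>R \<beta> q b)"
      by (intro smooth_fun_sum smooth_fun_scaleR smooth_fun_inner_left F that U \<beta>(2))
  qed (rule linear_basis_expansion[OF \<beta>(1), symmetric])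
  then have "smooth_fun A U v"
    unfolding v_def
    by (intro smooth_fun_sum smooth_fun_scaleR smooth_fun_divide smooth_fun_bilinear_apply[OF U G] F U nzG)
  moreover have "G q (v q) u = \<beta> q u" if q: "q \<in> U" for q u
  proof -
    have l: "linear (\<lambda>u. G q u w)" "linear (G q w)" for w using G(1)[OF q] by (auto simp: bilinear_def)
    have "G q (v q) x = \<beta> q x" if x: "x \<in> (\<lambda>i. F i q) ` Basis" for x
    proof -
      obtain j where j: "j \<in> Basis" "x = F j q" using x by blast
      have "G q (v q) (F j q) = (\<Sum>i\<in>Basis. \<beta> q (F i q) / G q (F i q) (F i q) * G q (F i q) (F j q))"
        unfolding v_def by (simp add: linear_sum[OF l(1)] linear_cmul[OF l(1)])
      also have "\<dots> = (\<Sum>i\<in>Basis. if i = j then \<beta> q (F j q) else 0)"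
        using orth[OF q _ j(1)] nzG[OF q j(1)] by (intro sum.cong refl) auto
      also have "\<dots> = \<beta> q (F j q)" using j by simp
      finally show ?thesis using j by simp
    qed
    moreover have "u \<in> span ((\<lambda>i. F i q) ` Basis)" using span[OF q] by simp
    ultimately show ?thesis using linear_eq_on_span[OF l(2) \<beta>(1)[OF q]] by blast
  qed
  ultimately show ?thesis by (rule that)
qed

end

section \<open>Orthogonal projection to the tangent spaces of an immersed manifold\<close>

locale riemannian_immersion = smooth_mapping A B \<iota>
  for A :: "('a::{t2_space, second_countable_topology}, 'e::euclidean_space) atlas"
    and B :: "('b::{t2_space, second_countable_topology}, 'f::euclidean_space) atlas"
    and \<iota> :: "'b \<Rightarrow> 'a" +
  fixes g :: "('a, 'e) metric"
  assumes metric: "riemannian_metric A g"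
    and push_inj: "inj_on (push B A \<iota> p) (tangent_space B p)"
begin

lemma metric_sym: "u \<in> tangent_space A p \<Longrightarrow> v \<in> tangent_space A p \<Longrightarrow> g p u v = g p v u"
  using metric[unfolded riemannian_metric_def, THEN conjunct1] by blast

lemma metric_add: "u \<in> tangent_space A p \<Longrightarrow> v \<in> tangent_space A p \<Longrightarrow> w \<in> tangent_space A p \<Longrightarrow>
    g p (tadd u v) w = g p u w + g p v w"
  using metric[unfolded riemannian_metric_def, THEN conjunct2, THEN conjunct1] by simp

lemma metric_scale: "u \<in> tangent_space A p \<Longrightarrow> v \<in> tangent_space A p \<Longrightarrow> g p (tscale a u) v = a * g p u v"
  using metric[unfolded riemannian_metric_def, THEN conjunct2, THEN conjunct2, THEN conjunct1] by simp

lemma metric_pos: "u \<in> tangent_space A p \<Longrightarrow> u \<noteq> tzero \<Longrightarrow> g p u u > 0"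
  using metric[unfolded riemannian_metric_def, THEN conjunct2, THEN conjunct2, THEN conjunct2, THEN conjunct1]
  by blast

lemma metric_coord_smooth: "c \<in> A \<Longrightarrow> smooth_fun A (fst c) (\<lambda>q. g q (coord_vec A c q u) (coord_vec A c q v))"
  using metric[unfolded riemannian_metric_def, THEN conjunct2, THEN conjunct2, THEN conjunct2, THEN conjunct2]
  by (intro smooth_fun_from_chart[OF _ open_chart order_refl]) simp_all

lemma metric_add_right: "u \<in> tangent_space A p \<Longrightarrow> v \<in> tangent_space A p \<Longrightarrow> w \<in> tangent_space A p \<Longrightarrow>
    g p w (tadd u v) = g p w u + g p w v"
  by (simp add: metric_sym[of w] metric_add tangent_add)

lemma metric_scale_right: "u \<in> tangent_space A p \<Longrightarrow> v \<in> tangent_space A p \<Longrightarrow>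
    g p v (tscale a u) = a * g p v u"
  by (simp add: metric_sym[of v] metric_scale tangent_scale)

lemma metric_zero: "v \<in> tangent_space A p \<Longrightarrow> g p tzero v = 0"
  using metric_scale[OF tangent_zero, of v p 0] by simp

lemma metric_sum:
  assumes "finite I" "\<And>i. i \<in> I \<Longrightarrow> f i \<in> tangent_space A p" "v \<in> tangent_space A p"
  shows "g p (tsum I (\<lambda>i. tscale (a i) (f i))) v = (\<Sum>i\<in>I. a i * g p (f i) v)"
  using assms(1,2)
  by (induction I rule: finite_induct)
    (simp_all add: metric_zero tsum_insert metric_add metric_scale tangent_scale tangent_sum assms(3))

lemma metric_along_smooth:
  assumes W: "field_along W" and W': "field_along W'"
  shows "smooth_fun B UNIV (\<lambda>p. g (\<iota> p) (W p) (W' p))"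
proof (rule M.smooth_fun_local)
  fix p
  obtain d where d: "d \<in> A" "\<iota> p \<in> fst d" using chart_cover by blast
  let ?N = "\<iota> -` fst d"
  have N: "open ?N" by (rule open_vimage_iota[OF open_chart[OF d(1)]])
  have co: "smooth_fun A (fst d) (\<lambda>q. g q (coord_vec A d q a) (coord_vec A d q b))" for a b
    by (rule metric_coord_smooth[OF d(1)])
  have "smooth_fun B ?N (\<lambda>q. \<Sum>a\<in>Basis. (W q d \<bullet> a) * (\<Sum>b\<in>Basis. (W' q d \<bullet> b) *
      g (\<iota> q) (coord_vec A d (\<iota> q) b) (coord_vec A d (\<iota> q) a)))"
    by (intro M.smooth_fun_sum M.smooth_fun_mult M.smooth_fun_inner_left N field_along_smooth[OF W d(1)]
        field_along_smooth[OF W' d(1)] smooth_pullback[OF co open_chart[OF d(1)]])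
  then have "smooth_fun B ?N (\<lambda>q. g (\<iota> q) (W q) (W' q))"
  proof (rule M.smooth_fun_cong[OF _ N])
    fix q assume "q \<in> ?N"
    then have q: "\<iota> q \<in> fst d" by simp
    note c = coord_vec_in[OF d(1) q]
    have 1: "g (\<iota> q) (W q) v = (\<Sum>a\<in>Basis. (W q d \<bullet> a) * g (\<iota> q) (coord_vec A d (\<iota> q) a) v)"
      if "v \<in> tangent_space A (\<iota> q)" for v
      using metric_sum[where f = "coord_vec A d (\<iota> q)" and a = "\<lambda>a. W q d \<bullet> a", OF finite_Basis c that]
        tangent_expansion[OF field_along_tangent[OF W] d(1) q] by simp
    have 2: "g (\<iota> q) (W' q) v = (\<Sum>a\<in>Basis. (W' q d \<bullet> a) * g (\<iota> q) (coord_vec A d (\<iota> q) a) v)"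
      if "v \<in> tangent_space A (\<iota> q)" for v
      using metric_sum[where f = "coord_vec A d (\<iota> q)" and a = "\<lambda>a. W' q d \<bullet> a", OF finite_Basis c that]
        tangent_expansion[OF field_along_tangent[OF W'] d(1) q] by simp
    show "(\<Sum>a\<in>Basis. (W q d \<bullet> a) * (\<Sum>b\<in>Basis. (W' q d \<bullet> b) *
        g (\<iota> q) (coord_vec A d (\<iota> q) b) (coord_vec A d (\<iota> q) a))) = g (\<iota> q) (W q) (W' q)"
      unfolding 1[OF field_along_tangent[OF W']] metric_sym[OF c field_along_tangent[OF W']] 2[OF c] ..
  qed
  then show "\<exists>N. open N \<and> p \<in> N \<and> smooth_fun B N (\<lambda>p. g (\<iota> p) (W p) (W' p))"
    using N d by blast
qed

text \<open>The induced metric in the coordinates of a chart of the submanifold.\<close>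

definition gram :: "('b, 'f) chart \<Rightarrow> 'b \<Rightarrow> 'f \<Rightarrow> 'f \<Rightarrow> real" where
  "gram c p u v = g (\<iota> p) (dm p (coord_vec B c p u)) (dm p (coord_vec B c p v))"

lemma coord_vec_linear:
  assumes "c \<in> B" "p \<in> fst c"
  shows "coord_vec B c p (u + v) = tadd (coord_vec B c p u) (coord_vec B c p v)"
    and "coord_vec B c p (a *\<^sub>R u) = tscale a (coord_vec B c p u)"
  by (rule M.tangent_eqI[OF _ _ assms];
      simp add: assms M.coord_vec_in M.coord_vec_same M.tangent_add M.tangent_scale tapply)+

lemma linear_metric_coord:
  assumes c: "c \<in> B" "p \<in> fst c" and w: "w \<in> tangent_space A (\<iota> p)"
  shows "linear (\<lambda>u. g (\<iota> p) w (dm p (coord_vec B c p u)))"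
  using M.coord_vec_in[OF c]
  by (intro linearI)
    (simp_all add: coord_vec_linear[OF c] tlinear_add[OF push_linear] tlinear_scale[OF push_linear]
      metric_add_right metric_scale_right push_tangent w)

lemma gram_props:
  assumes c: "c \<in> B" "p \<in> fst c"
  shows "bilinear (gram c p)" "gram c p u v = gram c p v u" "u \<noteq> 0 \<Longrightarrow> gram c p u u > 0"
proof -
  note t = push_tangent[OF M.coord_vec_in[OF c]]
  show sym: "gram c p u v = gram c p v u" for u v
    unfolding gram_def by (rule metric_sym[OF t t])
  have "linear (gram c p u)" for u
    unfolding gram_def by (rule linear_metric_coord[OF c t])
  then show "bilinear (gram c p)" using sym unfolding bilinear_def by simp
  show "gram c p u u > 0" if "u \<noteq> 0"
    unfolding gram_def
  proof (rule metric_pos[OF t])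
    have "coord_vec B c p u \<noteq> tzero"
      using M.coord_vec_same[OF c, of u] that by (auto simp: tzero_def)
    then show "dm p (coord_vec B c p u) \<noteq> tzero"
      using inj_onD[OF push_inj _ M.coord_vec_in[OF c] M.tangent_zero, of u] M.tlinear_zero[OF push_linear] by auto
  qed
qed

lemma smooth_metric_coord:
  assumes c: "c \<in> B" and W: "field_along W"
  shows "smooth_fun B (fst c) (\<lambda>p. g (\<iota> p) (W p) (dm p (coord_vec B c p u)))"
proof (rule M.smooth_fun_local)
  fix p assume "p \<in> fst c"
  then obtain N E where F: "M.local_frame c N E" "p \<in> N" using M.local_frame_exists[OF c] by blast
  note f = M.local_frameD[OF F(1)]
  have "smooth_fun B N (\<lambda>p. g (\<iota> p) (W p) (dm p (coord_vec B c p u)))"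
    by (rule M.smooth_fun_cong[OF M.smooth_fun_subset[OF metric_along_smooth[OF W push_field[OF f(4)[of u]]]] f(2)])
      (use f(5) in auto)
  then show "\<exists>N. open N \<and> p \<in> N \<and> smooth_fun B N (\<lambda>p. g (\<iota> p) (W p) (dm p (coord_vec B c p u)))"
    using f(2) F(2) by blast
qed

lemma smooth_gram:
  assumes c: "c \<in> B"
  shows "smooth_fun B (fst c) (\<lambda>p. gram c p u v)"
proof (rule M.smooth_fun_local)
  fix p assume "p \<in> fst c"
  then obtain N E where F: "M.local_frame c N E" "p \<in> N" using M.local_frame_exists[OF c] by blast
  note f = M.local_frameD[OF F(1)]
  have "smooth_fun B N (\<lambda>p. gram c p u v)"
    by (rule M.smooth_fun_cong[OF M.smooth_fun_subset[OF smooth_metric_coord[OF c push_field[OF f(4)[of u]]] f(3)] f(2)])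
      (use f(5) in \<open>auto simp: gram_def\<close>)
  then show "\<exists>N. open N \<and> p \<in> N \<and> smooth_fun B N (\<lambda>p. gram c p u v)"
    using f(2) F(2) by blast
qed

lemma normal_tangent: "w \<in> normal_space B A g \<iota> p \<Longrightarrow> w \<in> tangent_space A (\<iota> p)"
  by (simp add: normal_space_def)

lemma normal_add:
  "v \<in> normal_space B A g \<iota> p \<Longrightarrow> w \<in> normal_space B A g \<iota> p \<Longrightarrow> tadd v w \<in> normal_space B A g \<iota> p"
  by (simp add: normal_space_def tangent_add metric_add push_tangent)

lemma normal_scale: "v \<in> normal_space B A g \<iota> p \<Longrightarrow> tscale a v \<in> normal_space B A g \<iota> p"
  by (simp add: normal_space_def tangent_scale metric_scale push_tangent)

lemma push_normal_zero:
  assumes "v \<in> tangent_space B p" "dm p v \<in> normal_space B A g \<iota> p"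
  shows "v = tzero"
proof -
  have "g (\<iota> p) (dm p v) (dm p v) = 0" using assms by (simp add: normal_space_def)
  then have "dm p v = dm p tzero"
    using metric_pos[OF push_tangent[OF assms(1)]] M.tlinear_zero[OF push_linear] by fastforce
  then show ?thesis using inj_onD[OF push_inj _ assms(1) M.tangent_zero] by blast
qed

lemma tsub_tadd: "tsub (tadd v w) (tadd v' w') = tadd (tsub v v') (tsub w w')"
  by (simp add: tsub_def tadd_def fun_eq_iff)

lemma push_sub:
  "v \<in> tangent_space B p \<Longrightarrow> w \<in> tangent_space B p \<Longrightarrow> dm p (tsub v w) = tsub (dm p v) (dm p w)"
  by (simp add: tsub_eq tlinear_add[OF push_linear] tlinear_scale[OF push_linear] M.tangent_scale)

lemma tan_part_eq:
  assumes v: "v \<in> tangent_space B p" and n: "tsub w (dm p v) \<in> normal_space B A g \<iota> p"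
  shows "tan_part B A g \<iota> p w = v"
  unfolding tan_part_def
proof (rule the_equality)
  fix v' assume v': "v' \<in> tangent_space B p \<and> tsub w (dm p v') \<in> normal_space B A g \<iota> p"
  have "tsub (tsub w (dm p v)) (tsub w (dm p v')) = dm p (tsub v' v)"
    using push_sub[of v' p v] v v' by (simp add: tsub_def)
  then have "dm p (tsub v' v) \<in> normal_space B A g \<iota> p"
    using n v' normal_add normal_scale by (metis tsub_eq)
  then have "tsub v' v = tzero" using push_normal_zero M.tangent_sub v v' by blast
  then show "v' = v" by (simp add: tsub_def tzero_def fun_eq_iff)
qed (use v n in simp)

text \<open>Orthogonal projection to the tangent space is the solution of a linear system with
  the Gram matrix of the coordinate vectors.\<close>

lemma coord_solution_normal:
  assumes c: "c \<in> B" "p \<in> fst c" and w: "w \<in> tangent_space A (\<iota> p)"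
    and x: "\<And>u. gram c p x u = g (\<iota> p) w (dm p (coord_vec B c p u))"
  shows "tan_part B A g \<iota> p w = coord_vec B c p x"
    and "tsub w (dm p (coord_vec B c p x)) \<in> normal_space B A g \<iota> p"
proof -
  note t = M.coord_vec_in[OF c]
  show n: "tsub w (dm p (coord_vec B c p x)) \<in> normal_space B A g \<iota> p"
    unfolding normal_space_def
  proof (intro CollectI conjI ballI tangent_sub w push_tangent t)
    fix v assume v: "v \<in> tangent_space B p"
    have "g (\<iota> p) (tsub w (dm p (coord_vec B c p x))) (dm p v)
        = g (\<iota> p) w (dm p v) - g (\<iota> p) (dm p (coord_vec B c p x)) (dm p v)"
      by (simp add: tsub_eq metric_add metric_scale w push_tangent t v tangent_scale)
    then show "g (\<iota> p) (tsub w (dm p (coord_vec B c p x))) (dm p v) = 0"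
      using x[of "v c"] by (simp add: gram_def M.coord_vec_eq[OF v c])
  qed
  show "tan_part B A g \<iota> p w = coord_vec B c p x" by (rule tan_part_eq[OF t n])
qed

text \<open>Existence at a single point is the case of constant data in \<open>smooth_riesz\<close>.\<close>

lemma orthogonal_decomposition:
  assumes w: "w \<in> tangent_space A (\<iota> p)"
  shows "tan_part B A g \<iota> p w \<in> tangent_space B p" "nor_part B A g \<iota> p w \<in> normal_space B A g \<iota> p"
proof -
  obtain c where c: "c \<in> B" "p \<in> fst c" using M.chart_cover by blast
  obtain x where x: "\<And>u. gram c p (x p) u = g (\<iota> p) w (dm p (coord_vec B c p u))"
    using M.smooth_riesz[where U = UNIV and G = "\<lambda>q. gram c p" and \<beta> = "\<lambda>q u. g (\<iota> p) w (dm p (coord_vec B c p u))",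
      OF open_UNIV gram_props(1)[OF c] M.smooth_fun_const gram_props(2,3)[OF c] linear_metric_coord[OF c w] M.smooth_fun_const]
    by (metis UNIV_I)
  note * = coord_solution_normal[OF c w x]
  show "tan_part B A g \<iota> p w \<in> tangent_space B p" using * M.coord_vec_in[OF c] by simp
  show "nor_part B A g \<iota> p w \<in> normal_space B A g \<iota> p" using * by (simp add: nor_part_def)
qed

lemma tan_nor_sum: "tadd (dm p (tan_part B A g \<iota> p w)) (nor_part B A g \<iota> p w) = w"
  by (simp add: nor_part_def tadd_tsub)

lemma tan_part_add:
  assumes "v \<in> tangent_space A (\<iota> p)" "w \<in> tangent_space A (\<iota> p)"
  shows "tan_part B A g \<iota> p (tadd v w) = tadd (tan_part B A g \<iota> p v) (tan_part B A g \<iota> p w)"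
proof (rule tan_part_eq)
  note * = orthogonal_decomposition[OF assms(1)] orthogonal_decomposition[OF assms(2)]
  show "tadd (tan_part B A g \<iota> p v) (tan_part B A g \<iota> p w) \<in> tangent_space B p"
    using * by (simp add: M.tangent_add)
  have "tsub (tadd v w) (dm p (tadd (tan_part B A g \<iota> p v) (tan_part B A g \<iota> p w)))
      = tadd (nor_part B A g \<iota> p v) (nor_part B A g \<iota> p w)"
    using *(1,3) by (simp add: tlinear_add[OF push_linear] nor_part_def tsub_tadd)
  then show "tsub (tadd v w) (dm p (tadd (tan_part B A g \<iota> p v) (tan_part B A g \<iota> p w))) \<in> normal_space B A g \<iota> p"
    using * by (simp add: normal_add)
qed

lemma nor_part_add:
  assumes "v \<in> tangent_space A (\<iota> p)" "w \<in> tangent_space A (\<iota> p)"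
  shows "nor_part B A g \<iota> p (tadd v w) = tadd (nor_part B A g \<iota> p v) (nor_part B A g \<iota> p w)"
  using orthogonal_decomposition(1)[OF assms(1)] orthogonal_decomposition(1)[OF assms(2)]
  by (simp add: nor_part_def tan_part_add[OF assms] tlinear_add[OF push_linear] tsub_tadd)

lemma tan_part_field:
  assumes W: "field_along W"
  shows "(\<lambda>p. tan_part B A g \<iota> p (W p)) \<in> vector_fields B"
  unfolding M.vector_fields_iff
proof (intro conjI allI ballI orthogonal_decomposition(1) field_along_tangent[OF W])
  fix c assume c: "c \<in> B"
  obtain x where x: "smooth_fun B (fst c) x"
    "\<And>p u. p \<in> fst c \<Longrightarrow> gram c p (x p) u = g (\<iota> p) (W p) (dm p (coord_vec B c p u))"
    using M.smooth_riesz[where G = "gram c" and \<beta> = "\<lambda>p u. g (\<iota> p) (W p) (dm p (coord_vec B c p u))",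
      OF M.open_chart[OF c] gram_props(1)[OF c] smooth_gram[OF c] gram_props(2,3)[OF c]
        linear_metric_coord[OF c _ field_along_tangent[OF W]] smooth_metric_coord[OF c W]]
    by metis
  show "smooth_fun B (fst c) (\<lambda>p. tan_part B A g \<iota> p (W p) c)"
    by (rule M.smooth_fun_cong[OF x(1) M.open_chart[OF c]])
      (simp add: coord_solution_normal(1)[OF c _ field_along_tangent[OF W] x(2)] M.coord_vec_same[OF c])
qed

end

section \<open>The gauge equation on a submanifold\<close>

context riemannian_immersion begin

text \<open>The description of \<open>theta_tan\<close> is meaningful because the differential of an immersion
  is injective.\<close>

lemma theta_tan_push:
  assumes "D p \<subseteq> tangent_space B p" "v \<in> D p" "\<Theta> (\<iota> p) (dm p v) \<in> dm p ` D p"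
  shows "dm p (theta_tan B A \<iota> \<Theta> p v) = \<Theta> (\<iota> p) (dm p v)"
proof -
  obtain w where w: "w \<in> tangent_space B p" "dm p w = \<Theta> (\<iota> p) (dm p v)" using assms by force
  have "theta_tan B A \<iota> \<Theta> p v = w"
    unfolding theta_tan_def
  proof (rule the_equality)
    fix w' assume "w' \<in> tangent_space B p \<and> dm p w' = \<Theta> (\<iota> p) (dm p v)"
    then show "w' = w" using inj_onD[OF push_inj, of p w' w] w by simp
  qed (use w in simp)
  then show ?thesis using w by simp
qed

lemma induced_connection_field:
  assumes "affine_connection A nab" "X \<in> vector_fields B" "Y \<in> vector_fields B"
  shows "induced_connection B A g \<iota> nab X Y \<in> vector_fields B"
  unfolding induced_connection_def
  by (rule tan_part_field[OF along_deriv_field[OF assms(1,2) push_field[OF assms(3)]]])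

text \<open>Being autoparallel asks for \<open>\<nabla>\<^sub>X Y\<close> to be a smooth section; as the induced connection
  produces smooth fields, only the pointwise condition remains.\<close>

lemma autoparallel_iff:
  assumes "affine_connection A nab"
  shows "autoparallel B (induced_connection B A g \<iota> nab) D \<longleftrightarrow>
    (\<forall>X\<in>sections B D. \<forall>Y\<in>sections B D. \<forall>p. induced_connection B A g \<iota> nab X Y p \<in> D p)"
  using induced_connection_field[OF assms] unfolding autoparallel_def sections_def by blast

text \<open>The heart of the matter: \<open>\<nabla>\<^sub>X (\<Theta> Y) = \<Theta> (\<nabla>\<^sup>*\<^sub>X Y + h\<^sup>*(X, Y))\<close>, split into tangential
  and normal parts. Here \<open>Y\<close> is an arbitrary field of the submanifold and \<open>\<Theta> Y\<close> may have both parts.\<close>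

lemma gauss_weingarten_tensor:
  assumes nab: "affine_connection A nab" "affine_connection A nabs" and \<Theta>: "tensor_field11 A \<Theta>"
    and gauge: "\<forall>X\<in>vector_fields A. \<forall>Y\<in>vector_fields A. \<forall>p.
        nab X (\<lambda>q. \<Theta> q (Y q)) p = \<Theta> p (nabs X Y p)"
    and X: "X \<in> vector_fields B" and Y: "Y \<in> vector_fields B"
  defines "Z \<equiv> along_deriv B A \<iota> nab X (\<lambda>q. \<Theta> (\<iota> q) (dm q (Y q)))"
  shows "tan_part B A g \<iota> p (Z p) =
      tadd (P_part B A g \<iota> \<Theta> p (induced_connection B A g \<iota> nabs X Y p))
        (t_part B A g \<iota> \<Theta> p (second_form B A g \<iota> nabs X Y p))"
    and "nor_part B A g \<iota> p (Z p) =
      tadd (F_part B A g \<iota> \<Theta> p (induced_connection B A g \<iota> nabs X Y p))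
        (f_part B A g \<iota> \<Theta> p (second_form B A g \<iota> nabs X Y p))"
proof -
  define w where "w = along_deriv B A \<iota> nabs X (\<lambda>q. dm q (Y q)) p"
  define v where "v = tan_part B A g \<iota> p w"
  define n where "n = nor_part B A g \<iota> p w"
  have w: "w \<in> tangent_space A (\<iota> p)"
    unfolding w_def by (rule along_deriv_tangent[OF nab(2) M.vector_field_tangent[OF X] push_field[OF Y]])
  have v: "dm p v \<in> tangent_space A (\<iota> p)" and n: "n \<in> tangent_space A (\<iota> p)"
    using orthogonal_decomposition[OF w] by (auto simp: v_def n_def push_tangent normal_tangent)
  have "Z p = \<Theta> (\<iota> p) w"
    unfolding Z_def w_def
    by (rule tensor_along[OF nab \<Theta> gauge M.vector_field_tangent[OF X] push_field[OF Y]])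
  also have "\<dots> = \<Theta> (\<iota> p) (tadd (dm p v) n)" by (simp add: v_def n_def tan_nor_sum)
  also have "\<dots> = tadd (\<Theta> (\<iota> p) (dm p v)) (\<Theta> (\<iota> p) n)"
    by (rule tlinear_add[OF tensor_linear[OF \<Theta>] v n])
  finally have Z: "Z p = tadd (\<Theta> (\<iota> p) (dm p v)) (\<Theta> (\<iota> p) n)" .
  note t = tensor_tangent[OF \<Theta> v] tensor_tangent[OF \<Theta> n]
  show "tan_part B A g \<iota> p (Z p) =
      tadd (P_part B A g \<iota> \<Theta> p (induced_connection B A g \<iota> nabs X Y p))
        (t_part B A g \<iota> \<Theta> p (second_form B A g \<iota> nabs X Y p))"
    unfolding Z tan_part_add[OF t]
    by (simp add: P_part_def t_part_def induced_connection_def second_form_def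
        v_def n_def w_def)
  show "nor_part B A g \<iota> p (Z p) =
      tadd (F_part B A g \<iota> \<Theta> p (induced_connection B A g \<iota> nabs X Y p))
        (f_part B A g \<iota> \<Theta> p (second_form B A g \<iota> nabs X Y p))"
    unfolding Z nor_part_add[OF t]
    by (simp add: F_part_def f_part_def induced_connection_def second_form_def
        v_def n_def w_def)
qed

end

lemma tadd_eq_right: "tadd v w = w \<longleftrightarrow> v = tzero"
  by (simp add: tadd_def tzero_def fun_eq_iff)

theorem proposition3p6:
  fixes A :: "('a::{t2_space, second_countable_topology}, 'e::euclidean_space) atlas"
    and g :: "('a, 'e) metric"
    and nab nabs :: "('a, 'e) connection"
    and \<Theta> :: "('a, 'e) tensor11"
    and B :: "('b::{t2_space, second_countable_topology}, 'f::euclidean_space) atlas"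
    and \<iota> :: "'b \<Rightarrow> 'a"
    and D Dp :: "'b \<Rightarrow> ('b, 'f) tvec set"
  assumes "theta_statistical_manifold A g nab nabs \<Theta>"
    and "theta_CR_submanifold B A g \<Theta> \<iota> D Dp"
  shows "((\<forall>p. {v \<in> tangent_space B p. F_part B A g \<iota> \<Theta> p v = tzero} = D p) \<longrightarrow>
           (autoparallel B (induced_connection B A g \<iota> nabs) D \<longleftrightarrow>
            (\<forall>X\<in>sections B D. \<forall>Y\<in>sections B D. \<forall>p.
               second_form B A g \<iota> nab X (\<lambda>q. theta_tan B A \<iota> \<Theta> q (Y q)) p =
               f_part B A g \<iota> \<Theta> p (second_form B A g \<iota> nabs X Y p)))) \<and>
         ((\<forall>p. {v \<in> tangent_space B p. P_part B A g \<iota> \<Theta> p v = tzero} = Dp p) \<longrightarrow>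
           (autoparallel B (induced_connection B A g \<iota> nabs) Dp \<longleftrightarrow>
            (\<forall>U\<in>sections B Dp. \<forall>V\<in>sections B Dp. \<forall>p.
               tadd (shape_operator B A g \<iota> nab (\<lambda>q. \<Theta> (\<iota> q) (push B A \<iota> q (V q))) U p)
                    (t_part B A g \<iota> \<Theta> p (second_form B A g \<iota> nabs U V p)) = tzero)))"
proof -
  note st = assms(1)[unfolded theta_statistical_manifold_def statistical_manifold_def]
  note cr = assms(2)[unfolded theta_CR_submanifold_def immersion_def]
  interpret riemannian_immersion A B \<iota> g
    by unfold_locales (use st cr in auto)
  have nab: "affine_connection A nab" "affine_connection A nabs" and \<Theta>: "tensor_field11 A \<Theta>"
    and gauge: "\<forall>X\<in>vector_fields A. \<forall>Y\<in>vector_fields A. \<forall>p.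
        nab X (\<lambda>q. \<Theta> q (Y q)) p = \<Theta> p (nabs X Y p)"
    using st by blast+
  note gw = gauss_weingarten_tensor[OF nab \<Theta> gauge]
  have vf: "X \<in> vector_fields B" if "X \<in> sections B D'" for X D' using that by (simp add: sections_def)
  let ?C = "induced_connection B A g \<iota> nabs"
  have C: "?C X Y p \<in> tangent_space B p" if "X \<in> sections B D'" "Y \<in> sections B D'" for X Y p D'
    by (rule M.vector_field_tangent[OF induced_connection_field[OF nab(2) vf[OF that(1)] vf[OF that(2)]]])
  show ?thesis
  proof (intro conjI impI)
    assume ker: "\<forall>p. {v \<in> tangent_space B p. F_part B A g \<iota> \<Theta> p v = tzero} = D p"
    \<comment> \<open>By the kernel condition, \<open>\<nabla>\<^sup>*\<^sub>X Y\<close> lies in \<open>D\<close> iff the term \<open>F (\<nabla>\<^sup>*\<^sub>X Y)\<close> of the normal part vanishes.\<close>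
    have "?C X Y p \<in> D p \<longleftrightarrow> second_form B A g \<iota> nab X (\<lambda>q. theta_tan B A \<iota> \<Theta> q (Y q)) p =
        f_part B A g \<iota> \<Theta> p (second_form B A g \<iota> nabs X Y p)"
      if X: "X \<in> sections B D" and Y: "Y \<in> sections B D" for X Y p
    proof -
      have "push B A \<iota> q (theta_tan B A \<iota> \<Theta> q (Y q)) = \<Theta> (\<iota> q) (push B A \<iota> q (Y q))" for q
      proof (rule theta_tan_push)
        show "D q \<subseteq> tangent_space B q" using ker by blast
        show "Y q \<in> D q" using Y by (simp add: sections_def)
        then show "\<Theta> (\<iota> q) (push B A \<iota> q (Y q)) \<in> push B A \<iota> q ` D q" using cr by blast
      qed
      then have "second_form B A g \<iota> nab X (\<lambda>q. theta_tan B A \<iota> \<Theta> q (Y q)) p =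
          tadd (F_part B A g \<iota> \<Theta> p (?C X Y p)) (f_part B A g \<iota> \<Theta> p (second_form B A g \<iota> nabs X Y p))"
        using gw(2)[OF vf[OF X] vf[OF Y], of p]
        unfolding second_form_def[of B A g \<iota> nab] by simp
      moreover have "?C X Y p \<in> D p \<longleftrightarrow> F_part B A g \<iota> \<Theta> p (?C X Y p) = tzero"
        using ker C[OF X Y, of p] by blast
      ultimately show ?thesis by (simp add: tadd_eq_right)
    qed
    then show "autoparallel B ?C D \<longleftrightarrow> (\<forall>X\<in>sections B D. \<forall>Y\<in>sections B D. \<forall>p.
        second_form B A g \<iota> nab X (\<lambda>q. theta_tan B A \<iota> \<Theta> q (Y q)) p =
        f_part B A g \<iota> \<Theta> p (second_form B A g \<iota> nabs X Y p))"
      by (simp add: autoparallel_iff[OF nab(2)])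
  next
    assume ker: "\<forall>p. {v \<in> tangent_space B p. P_part B A g \<iota> \<Theta> p v = tzero} = Dp p"
    \<comment> \<open>The shape operator carries a minus sign, so the sum in question is \<open>- P (\<nabla>\<^sup>*\<^sub>U V)\<close>.\<close>
    have "?C U V p \<in> Dp p \<longleftrightarrow>
        tadd (shape_operator B A g \<iota> nab (\<lambda>q. \<Theta> (\<iota> q) (push B A \<iota> q (V q))) U p)
          (t_part B A g \<iota> \<Theta> p (second_form B A g \<iota> nabs U V p)) = tzero"
      if U: "U \<in> sections B Dp" and V: "V \<in> sections B Dp" for U V p
    proof -
      have "tadd (shape_operator B A g \<iota> nab (\<lambda>q. \<Theta> (\<iota> q) (push B A \<iota> q (V q))) U p)
          (t_part B A g \<iota> \<Theta> p (second_form B A g \<iota> nabs U V p))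
          = tscale (- 1) (P_part B A g \<iota> \<Theta> p (?C U V p))"
        using gw(1)[OF vf[OF U] vf[OF V], of p]
        by (simp add: shape_operator_def tadd_def tscale_def fun_eq_iff)
      moreover have "?C U V p \<in> Dp p \<longleftrightarrow> P_part B A g \<iota> \<Theta> p (?C U V p) = tzero"
        using ker C[OF U V, of p] by blast
      ultimately show ?thesis by (simp add: tscale_def tzero_def fun_eq_iff)
    qed
    then show "autoparallel B ?C Dp \<longleftrightarrow> (\<forall>U\<in>sections B Dp. \<forall>V\<in>sections B Dp. \<forall>p.
        tadd (shape_operator B A g \<iota> nab (\<lambda>q. \<Theta> (\<iota> q) (push B A \<iota> q (V q))) U p)
          (t_part B A g \<iota> \<Theta> p (second_form B A g \<iota> nabs U V p)) = tzero)"
      by (simp add: autoparallel_iff[OF nab(2)])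
  qed
qed

end
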